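(* For a topological group $G$, the following conditions are equivalent. (1) $G$ is non-precompact. (2) $G$ admits a fixed point-free continuous action by affine isometries on a Banach space. (3) $G$ admits a strongly moving continuous action by affine isometries on some Banach space.
   Context: Topological groups are assumed Hausdorff. A topological group $G$ is precompact if for every neighbourhood $V$ of the identity there is a finite set $F\subseteq G$ with $FV=G$. An action by affine isometries on a Banach space $E$ is a homomorphism from $G$ to the group of surjective affine isometries of $E$; it is continuous if the map $G\times E\to E$ is jointly continuous (equivalently, all orbit maps $g\mapsto gx$ are continuous). Fixed point-free means that there is no $\xi\in E$ with $g\xi=\xi$ for all $g\in G$. An action of $G$ by isometries on a metric space $X$ is strongly moving with constant $\varepsilon_0>0$ if for every finite subset $F\subseteq X$ there is $g\in G$ with $d_X(F,gF)\ge\varepsilon_0$, where $d_X(A,B)=\inf\{d_X(a,b):a\in A,b\in B\}$; it is strongly moving if it is so with some constant $\varepsilon_0>0$. *)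

theory Defs
  imports
    "HOL-Analysis.Analysis"
    "HOL-Algebra.Module"
    "HOL-Library.Set_Algebras"
begin

text \<open>
  Topological groups are types of the sort \<open>{topological_group_add, t2_space}\<close>; the class
  \<open>group_add\<close> does not assume commutativity, so \<open>g + h\<close>, \<open>0\<close>, \<open>- g\<close> and \<open>F + V\<close> stand for
  \<open>gh\<close>, \<open>1\<close>, \<open>g\<^sup>-\<^sup>1\<close> and \<open>FV\<close>.
\<close>

definition precompact_group :: "'g::{topological_group_add, t2_space} itself \<Rightarrow> bool" where
  "precompact_group _ \<longleftrightarrow>
     (\<forall>V::'g set. 0 \<in> interior V \<longrightarrow> (\<exists>F. finite F \<and> F + V = UNIV))"

text \<open>
  The Banach space in an existential statement cannot be a type, so real normed spaces are given by
  a carrier set and operations. The fields \<open>mult\<close> and \<open>one\<close> of a module record play no role.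
\<close>

definition real_ring :: "real ring" where
  "real_ring = \<lparr>carrier = UNIV, mult = (*), one = 1, zero = 0, add = (+)\<rparr>"

locale real_normed_space = module real_ring E
  for E :: "(real, 'v) module" (structure) +
  fixes N :: "'v \<Rightarrow> real"
  assumes norm_zeroD: "\<lbrakk>x \<in> carrier E; N x = 0\<rbrakk> \<Longrightarrow> x = \<zero>\<^bsub>E\<^esub>"
    and norm_smult: "x \<in> carrier E \<Longrightarrow> N (a \<odot>\<^bsub>E\<^esub> x) = \<bar>a\<bar> * N x"
    and norm_triangle: "\<lbrakk>x \<in> carrier E; y \<in> carrier E\<rbrakk> \<Longrightarrow> N (x \<oplus>\<^bsub>E\<^esub> y) \<le> N x + N y"
begin

text \<open>The value off the carrier is immaterial, but \<open>Metric_space\<close> asks for a distance that is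
  symmetric and nonnegative on the whole type.\<close>

definition ndist :: "'v \<Rightarrow> 'v \<Rightarrow> real" where
  "ndist x y = (if x \<in> carrier E \<and> y \<in> carrier E then N (x \<ominus>\<^bsub>E\<^esub> y) else 0)"

lemma smult_minus_one: "x \<in> carrier E \<Longrightarrow> (-1) \<odot>\<^bsub>E\<^esub> x = \<ominus>\<^bsub>E\<^esub> x"
  using smult_l_minus[of 1 x] smult_one[of x] R.add.inv_equality[of "-1" 1]
  by (simp add: real_ring_def)

lemma norm_minus: "x \<in> carrier E \<Longrightarrow> N (\<ominus>\<^bsub>E\<^esub> x) = N x"
  using norm_smult[of x "-1"] smult_minus_one[of x] by simp

lemma norm_zero: "N \<zero>\<^bsub>E\<^esub> = 0"
  using norm_smult[of "\<zero>\<^bsub>E\<^esub>" 0] smult_r_null[of 0] by (simp add: real_ring_def)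

lemma norm_nonneg: "x \<in> carrier E \<Longrightarrow> 0 \<le> N x"
  using norm_triangle[of x "\<ominus>\<^bsub>E\<^esub> x"] norm_minus[of x] norm_zero by (simp add: M.r_neg)

sublocale metric: Metric_space "carrier E" ndist
proof
  fix x y
  show "0 \<le> ndist x y" by (simp add: ndist_def norm_nonneg)
  show "ndist x y = ndist y x"
    using norm_minus[of "x \<ominus>\<^bsub>E\<^esub> y"] by (auto simp: ndist_def M.minus_eq M.minus_add M.a_comm)
next
  fix x y assume "x \<in> carrier E" "y \<in> carrier E"
  moreover from this have "x \<ominus>\<^bsub>E\<^esub> y = \<zero>\<^bsub>E\<^esub> \<longleftrightarrow> x = y"
    by (metis M.a_inv_closed M.minus_eq M.minus_equality M.minus_minus M.r_neg)
  ultimately show "ndist x y = 0 \<longleftrightarrow> x = y"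
    using norm_zeroD[of "x \<ominus>\<^bsub>E\<^esub> y"] norm_zero by (auto simp: ndist_def)
next
  fix x y z assume xyz: "x \<in> carrier E" "y \<in> carrier E" "z \<in> carrier E"
  have "(x \<ominus>\<^bsub>E\<^esub> y) \<oplus>\<^bsub>E\<^esub> (y \<ominus>\<^bsub>E\<^esub> z) = x \<ominus>\<^bsub>E\<^esub> z"
    using xyz by (simp add: M.minus_eq M.a_assoc M.r_neg1)
  then show "ndist x z \<le> ndist x y + ndist y z"
    using xyz norm_triangle[of "x \<ominus>\<^bsub>E\<^esub> y" "y \<ominus>\<^bsub>E\<^esub> z"] by (simp add: ndist_def)
qed

definition affine_isometries :: "('v \<Rightarrow> 'v) set" where
  "affine_isometries = {T. T ` carrier E = carrier E \<and>
     (\<forall>x\<in>carrier E. \<forall>y\<in>carrier E. ndist (T x) (T y) = ndist x y) \<and>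
     (\<forall>x\<in>carrier E. \<forall>y\<in>carrier E. \<forall>t.
        T (((1 - t) \<odot>\<^bsub>E\<^esub> x) \<oplus>\<^bsub>E\<^esub> (t \<odot>\<^bsub>E\<^esub> y)) = ((1 - t) \<odot>\<^bsub>E\<^esub> T x) \<oplus>\<^bsub>E\<^esub> (t \<odot>\<^bsub>E\<^esub> T y))}"

end

locale real_banach_space = real_normed_space +
  assumes complete: "metric.mcomplete"

locale continuous_affine_isometric_action = real_banach_space E N
  for E :: "(real, 'v) module" (structure) and N :: "'v \<Rightarrow> real" +
  fixes \<phi> :: "'g::{topological_group_add, t2_space} \<Rightarrow> 'v \<Rightarrow> 'v"
  assumes affine_isometry: "\<phi> g \<in> affine_isometries"
    and action_zero: "x \<in> carrier E \<Longrightarrow> \<phi> 0 x = x"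
    and action_add: "x \<in> carrier E \<Longrightarrow> \<phi> (g + h) x = \<phi> g (\<phi> h x)"
    and jointly_continuous:
      "continuous_map (prod_topology euclidean metric.mtopology) metric.mtopology (\<lambda>(g, x). \<phi> g x)"

definition fixed_point_free :: "'v set \<Rightarrow> ('g \<Rightarrow> 'v \<Rightarrow> 'v) \<Rightarrow> bool" where
  "fixed_point_free X \<phi> \<longleftrightarrow> \<not> (\<exists>\<xi>\<in>X. \<forall>g. \<phi> g \<xi> = \<xi>)"

text \<open>Extended reals, so that the infimum over the empty set is \<open>\<infinity>\<close>.\<close>

definition set_distance :: "('v \<Rightarrow> 'v \<Rightarrow> real) \<Rightarrow> 'v set \<Rightarrow> 'v set \<Rightarrow> ereal" where
  "set_distance d A B = (INF a\<in>A. INF b\<in>B. ereal (d a b))"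

definition strongly_moving_with ::
    "real \<Rightarrow> 'v set \<Rightarrow> ('v \<Rightarrow> 'v \<Rightarrow> real) \<Rightarrow> ('g \<Rightarrow> 'v \<Rightarrow> 'v) \<Rightarrow> bool" where
  "strongly_moving_with \<epsilon> X d \<phi> \<longleftrightarrow>
     (\<forall>F. finite F \<and> F \<subseteq> X \<longrightarrow> (\<exists>g. ereal \<epsilon> \<le> set_distance d F (\<phi> g ` F)))"

definition strongly_moving ::
    "'v set \<Rightarrow> ('v \<Rightarrow> 'v \<Rightarrow> real) \<Rightarrow> ('g \<Rightarrow> 'v \<Rightarrow> 'v) \<Rightarrow> bool" where
  "strongly_moving X d \<phi> \<longleftrightarrow> (\<exists>\<epsilon>>0. strongly_moving_with \<epsilon> X d \<phi>)"

text \<open>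
  HOL cannot quantify existentially over types, so the points of the Banach spaces that are
  considered for a group \<open>'g\<close> are drawn from the type below. The type \<open>'u\<close> is arbitrary: every
  Banach space whose carrier lies in any type \<open>'u\<close> has a copy here, via \<open>Inl\<close>. The second
  summand only ensures that, whatever \<open>'u\<close> is, there are enough points: the closed affine span of
  an orbit of an infinite group has at most as many points as there are functions from the group
  to the reals.
\<close>

type_synonym ('g, 'u) points = "'u + (('g \<Rightarrow> real) \<Rightarrow> real)"

end

theory Submission
  imports Defs
begin

text \<open>
  A strongly moving action has no fixed point, because a fixed point is at distance zero from its
  translates. It remains to prove that precompact groups always have fixed points and that all
  other groups have strongly moving actions; the two arguments are independent.

  A precompact group fixes a point of every space on which it acts. The orbit of a point is
  totally bounded, and this holds uniformly over its closed convex hull: a single finite set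
  \<open>H\<close> of group elements approximates the whole group up to \<open>\<epsilon>\<close> in its action on all points of the
  hull (\<open>finite_net_uniform_on_orbit\<close>). If the orbit of \<open>y\<close> has diameter at most \<open>r \<ge> 2\<epsilon>\<close>, every
  orbit point is within \<open>r\<close> of all the points \<open>h y\<close>, \<open>h \<in> H\<close>, and within \<open>r / 2\<close> of one of them,
  so a barycentre of these points is at distance at most \<open>q r\<close> from each orbit point, where \<open>q < 1\<close>
  depends on \<open>card H\<close> only (\<open>orbit_diameter_contraction\<close>). Iterated averaging produces
  points with arbitrarily small orbits, and these can be chosen to converge.

  For a group that is not precompact, the first step is combinatorial: there is a neighbourhood
  \<open>U\<close> of the identity such that no finite \<open>S\<close> satisfies \<open>G = S U S\<^sup>-\<^sup>1\<close>. The reason is that a finite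
  union of left translates of sets \<open>A\<^sub>1, \<dots>, A\<^sub>n\<close> can be the whole group only if finitely many left
  translates of some \<open>A\<^sub>i A\<^sub>i\<^sup>-\<^sup>1\<close> are enough (\<open>finite_cover_imp_syndetic_differences\<close>). This is applied
  to the conjugates of \<open>U\<close>. The Birkhoff--Kakutani construction then yields a continuous length \<open>l\<close> on \<open>G\<close>
  whose ball of radius \<open>1/2\<close> lies in \<open>U\<close>. Hence for every finite \<open>S\<close> some \<open>g\<close> moves \<open>S\<close> to a
  set at distance at least \<open>1/2\<close> from \<open>S\<close>, for the left-invariant distance \<open>l (x\<^sup>-\<^sup>1 y)\<close>
  (\<open>non_precompact_imp_moving_length\<close>).

  This is transferred to a Banach space by letting points of \<open>G\<close> act as evaluations on the set of
  \<open>1\<close>-Lipschitz functions. The group acts on functionals \<open>T\<close> by translation, and the cocycle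
  \<open>f \<mapsto> f g - f 0\<close>, the difference of two evaluations, makes the action affine. The functionals are
  required to ignore additive constants and to be determined up to small errors by finitely many
  values of their argument. So, given finitely many of them, one finite \<open>S\<close> serves for all, and a
  Lipschitz function that is \<open>0\<close> on \<open>S\<close> and \<open>1/2\<close> on \<open>g S\<close> is almost annihilated by the
  functionals and by their translates, while the cocycle takes the value \<open>1/2\<close> there
  (\<open>functional_action_strongly_moving\<close>).
\<close>

section \<open>Finite covers by two-sided translates\<close>

text \<open>
  Induction on the number of sets. If translating the differences of \<open>A j\<close> by \<open>F j\<close> does not
  give the whole group, then \<open>A j\<close> is superfluous up to finite translation: finitely many left
  translates of the complement of \<open>F j + A j\<close> cover the group, so that the other sets alone do
  after enlarging the \<open>F i\<close>.
\<close>

lemma finite_cover_imp_syndetic_differences: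
  fixes A :: "'i \<Rightarrow> 'g::group_add set"
  assumes "finite I" and "\<And>i. i \<in> I \<Longrightarrow> finite (F i)" and "(\<Union>i\<in>I. F i + A i) = UNIV"
  shows "\<exists>i\<in>I. \<exists>K. finite K \<and> K + {a - b |a b. a \<in> A i \<and> b \<in> A i} = UNIV"
  using assms
proof (induction I arbitrary: F)
  case empty
  then show ?case by simp
next
  case (insert j I)
  define D where "D = {a - b |a b. a \<in> A j \<and> b \<in> A j}"
  show ?case
  proof (cases "F j + D = UNIV")
    case True
    then show ?thesis
      using insert.prems(1)[of j] unfolding D_def by blast
  next
    case False
    then obtain h where h: "h \<notin> F j + D" by blast
    (* If g = f + a were in F j + A j together with all its translates by K, then
       so would be (h - f) + g = h + a, which puts h into F j + D. *)
    define K where "K = insert 0 ((\<lambda>f. h - f) ` F j)"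
    have "finite K" by (simp add: K_def insert.prems)
    have escape: "\<exists>k\<in>K. k + g \<notin> F j + A j" for g
    proof (rule ccontr)
      assume "\<not> ?thesis"
      then have all: "\<And>k. k \<in> K \<Longrightarrow> k + g \<in> F j + A j" by blast
      have "g \<in> F j + A j" using all[of 0] by (simp add: K_def)
      then obtain f a where fa: "f \<in> F j" "a \<in> A j" "g = f + a" by (auto simp: set_plus_def)
      have "h - f + g \<in> F j + A j" using all[of "h - f"] fa(1) by (simp add: K_def)
      then obtain f' a' where f': "f' \<in> F j" "a' \<in> A j" "h + a = f' + a'"
        by (auto simp: set_plus_def fa(3) diff_conv_add_uminus add.assoc simp del: add_uminus_conv_diff)
      then have "h = f' + (a' - a)" by (metis add_diff_cancel add_diff_eq)
      then show False using h f' fa(2) by (auto simp: set_plus_def D_def)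
    qed
    define F' where "F' i = (uminus ` K) + F i" for i
    have "g \<in> (\<Union>i\<in>I. F' i + A i)" for g
    proof -
      obtain k where k: "k \<in> K" "k + g \<notin> F j + A j" using escape by blast
      then obtain i where i: "i \<in> I" "k + g \<in> F i + A i" using insert.prems(2) by blast
      then obtain f a where "f \<in> F i" "a \<in> A i" "k + g = f + a" by (auto simp: set_plus_def)
      moreover from this have "g = (- k + f) + a" by (metis add.assoc minus_add_cancel)
      ultimately show ?thesis using i(1) k(1) by (auto simp: F'_def set_plus_def)
    qed
    then have "(\<Union>i\<in>I. F' i + A i) = UNIV" by blast
    moreover have "finite (F' i)" if "i \<in> I" for i
      using that insert.prems(1) \<open>finite K\<close>
      by (simp add: F'_def finite_set_plus)
    ultimately show ?thesis using insert.IH[of F'] by auto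
  qed
qed

text \<open>
  A two-sided translate \<open>s + U - t\<close> is a left translate of the conjugate \<open>t + U - t\<close>. So the
  preceding lemma applies to the finitely many conjugates, and the differences of a conjugate are
  conjugates of differences, where the remaining right translation can be absorbed into \<open>K\<close>.
\<close>

lemma two_sided_syndetic_imp_syndetic_differences:
  fixes U :: "'g::group_add set"
  assumes "finite S" and cover: "\<And>g. \<exists>s\<in>S. \<exists>t\<in>S. - s + g + t \<in> U"
  shows "\<exists>K. finite K \<and> K + {u - v |u v. u \<in> U \<and> v \<in> U} = UNIV"
proof -
  define A where "A t = {t + u - t |u. u \<in> U}" for t
  have "g \<in> (\<Union>t\<in>S. (\<lambda>s. s - t) ` S + A t)" for g
  proof -
    obtain s t where st: "s \<in> S" "t \<in> S" "- s + g + t \<in> U" using cover by blast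
    have "g = (s - t) + (t + (- s + g + t) - t)"
      by (simp add: diff_conv_add_uminus add.assoc del: add_uminus_conv_diff)
    then show ?thesis using st unfolding A_def set_plus_def by blast
  qed
  then have "(\<Union>t\<in>S. (\<lambda>s. s - t) ` S + A t) = UNIV" by blast
  then obtain t K where K: "finite K" "K + {a - b |a b. a \<in> A t \<and> b \<in> A t} = UNIV"
    using finite_cover_imp_syndetic_differences[of S "\<lambda>t. (\<lambda>s. s - t) ` S" A] \<open>finite S\<close> by blast
  have "g \<in> (\<lambda>k. k + t) ` K + {u - v |u v. u \<in> U \<and> v \<in> U}" for g
  proof -
    have "g - t \<in> K + {a - b |a b. a \<in> A t \<and> b \<in> A t}" using K(2) by blast
    then obtain k u v where k: "k \<in> K" "u \<in> U" "v \<in> U" "g - t = k + ((t + u - t) - (t + v - t))"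
      by (auto simp: set_plus_def A_def)
    have "(t + u - t) - (t + v - t) = t + (u - v) - t"
      by (simp add: diff_conv_add_uminus minus_add add.assoc del: add_uminus_conv_diff)
    then have "g = (k + t) + (u - v)" using k(4) by (metis add.assoc add_diff_eq diff_add_cancel)
    then show ?thesis using k unfolding set_plus_def by blast
  qed
  then show ?thesis using K(1) by blast
qed

section \<open>Continuous lengths on topological groups\<close>

text \<open>
  A length is the same thing as a left-invariant continuous pseudometric, \<open>l (- x + y)\<close>.
\<close>

locale group_length =
  fixes l :: "'g::topological_group_add \<Rightarrow> real"
  assumes length_add: "l (g + h) \<le> l g + l h"
    and length_minus: "l (- g) = l g"
    and length_zero: "l 0 = 0"
    and length_small: "0 < e \<Longrightarrow> eventually (\<lambda>g. l g < e) (nhds 0)"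
begin

lemma length_nonneg: "0 \<le> l g"
  using length_add[of g "- g"] by (simp add: length_minus length_zero)

end

text \<open>
  A finite sequence of weights can be cut at one entry so that the two remaining parts obey
  prescribed bounds with sum greater than the total weight. This is the step that lets the chain
  argument of the metrization lemma use only cubes of neighbourhoods.
\<close>

lemma split_at_weight:
  fixes w :: "'a \<Rightarrow> real"
  assumes "\<And>x. 0 \<le> w x" "xs \<noteq> []" "(\<Sum>x\<leftarrow>xs. w x) < a + b" "0 < a" "0 < b"
  shows "\<exists>ys x zs. xs = ys @ x # zs \<and> (\<Sum>x\<leftarrow>ys. w x) < a \<and> (\<Sum>x\<leftarrow>zs. w x) < b"
  using assms(2-)
proof (induction xs arbitrary: a)
  case Nil
  then show ?case by simp
next
  case (Cons x xs)
  show ?case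
  proof (cases "(\<Sum>x\<leftarrow>xs. w x) < b")
    case True
    then show ?thesis using Cons.prems by (intro exI[of _ "[]"]) auto
  next
    case False
    then have "xs \<noteq> []" "(\<Sum>x\<leftarrow>xs. w x) < (a - w x) + b" "0 < a - w x"
      using Cons.prems by auto
    then obtain ys y zs where "xs = ys @ y # zs" "(\<Sum>x\<leftarrow>ys. w x) < a - w x" "(\<Sum>x\<leftarrow>zs. w x) < b"
      using Cons.IH[of "a - w x"] Cons.prems by blast
    then show ?thesis by (intro exI[of _ "x # ys"] exI[of _ y] exI[of _ zs]) auto
  qed
qed

lemma symmetric_cube_root:
  fixes V :: "'g::topological_group_add set"
  assumes "open V" "0 \<in> V"
  shows "\<exists>W. open W \<and> 0 \<in> W \<and> (\<forall>w\<in>W. - w \<in> W) \<and> (\<forall>a\<in>W. \<forall>b\<in>W. \<forall>c\<in>W. a + b + c \<in> V)"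
proof -
  let ?O = "(\<lambda>p::'g \<times> 'g \<times> 'g. fst p + fst (snd p) + snd (snd p)) -` V"
  have "open ?O" by (intro open_vimage assms continuous_intros)
  moreover have "(0, 0, 0) \<in> ?O" using assms by simp
  ultimately obtain A B where A: "open A" "open B" "(0, 0, 0) \<in> A \<times> B" "A \<times> B \<subseteq> ?O"
    by (rule open_prod_elim)
  have "(0, 0) \<in> B" using A(3) by simp
  with A(2) obtain B1 B2 where B: "open B1" "open B2" "(0, 0) \<in> B1 \<times> B2" "B1 \<times> B2 \<subseteq> B"
    by (rule open_prod_elim)
  define W0 where "W0 = A \<inter> B1 \<inter> B2"
  define W where "W = W0 \<inter> uminus -` W0"
  have "open W" unfolding W_def W0_def using A B
    by (intro open_Int open_vimage continuous_intros) auto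
  moreover have "0 \<in> W" using A B by (simp add: W_def W0_def)
  moreover have "\<forall>w\<in>W. - w \<in> W" by (simp add: W_def)
  moreover have "a + b + c \<in> V" if "a \<in> W" "b \<in> W" "c \<in> W" for a b c
  proof -
    have "(a, b, c) \<in> A \<times> B" using that A B(4) by (auto simp: W_def W0_def)
    then show ?thesis using A(4) by auto
  qed
  ultimately show ?thesis by (intro exI[of _ W]) simp
qed

text \<open>
  The Birkhoff--Kakutani construction. Choose symmetric neighbourhoods \<open>W n\<close> whose cubes lie in
  their predecessors, starting from the whole group and \<open>W 1 \<subseteq> U\<close>. The length of \<open>g\<close> is the
  infimum of the weights of all ways to write \<open>g\<close> as a product, where a factor declared to be in
  \<open>W n\<close> costs \<open>(1/2) ^ n\<close>. This is subadditive by construction. What needs proof is that a cheap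
  product is small: weight less than \<open>(1/2) ^ m\<close> forces the product into \<open>W m\<close>.
\<close>

lemma exists_group_length:
  fixes U :: "'g::topological_group_add set"
  assumes "open U" "0 \<in> U"
  shows "\<exists>l. group_length l \<and> (\<forall>g. l g < 1/2 \<longrightarrow> g \<in> U)"
proof -
  define P where "P W \<longleftrightarrow> open W \<and> (0::'g) \<in> W \<and> (\<forall>w\<in>W. - w \<in> W)" for W
  define Q where "Q W W' \<longleftrightarrow> W' \<subseteq> U \<and> (\<forall>a\<in>W'. \<forall>b\<in>W'. \<forall>c\<in>W'. a + b + c \<in> W)" for W W' :: "'g set"
  have "\<exists>W. \<forall>n. (P (W n) \<and> (n = 0 \<longrightarrow> W n = UNIV)) \<and> Q (W n) (W (Suc n))"
  proof (rule dependent_nat_choice)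
    show "\<exists>W. P W \<and> (0 = (0::nat) \<longrightarrow> W = UNIV)" by (auto simp: P_def)
  next
    fix W and n :: nat assume "P W \<and> (n = 0 \<longrightarrow> W = UNIV)"
    then have "open (W \<inter> U)" "0 \<in> W \<inter> U" using assms by (auto simp: P_def)
    then obtain W' where W': "open W'" "0 \<in> W'" "\<forall>w\<in>W'. - w \<in> W'"
        "\<forall>a\<in>W'. \<forall>b\<in>W'. \<forall>c\<in>W'. a + b + c \<in> W \<inter> U"
      using symmetric_cube_root[of "W \<inter> U"] by metis
    have "W' \<subseteq> U"
    proof
      fix a assume "a \<in> W'"
      then have "a + 0 + 0 \<in> W \<inter> U" using W'(2,4) by blast
      then show "a \<in> U" by simp
    qed
    then show "\<exists>W'. (P W' \<and> (Suc n = 0 \<longrightarrow> W' = UNIV)) \<and> Q W W'"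
      using W' by (intro exI[of _ W']) (auto simp: P_def Q_def)
  qed
  then obtain W :: "nat \<Rightarrow> 'g set"
    where "\<forall>n. (P (W n) \<and> (n = 0 \<longrightarrow> W n = UNIV)) \<and> Q (W n) (W (Suc n))" ..
  then have W: "P (W n)" "W 0 = UNIV" "Q (W n) (W (Suc n))" for n by simp_all
  have zero_W: "0 \<in> W n" and open_W: "open (W n)" and minus_W: "w \<in> W n \<Longrightarrow> - w \<in> W n" for n w
    using W(1)[of n] by (auto simp: P_def)
  have cube_W: "a \<in> W (Suc n) \<Longrightarrow> b \<in> W (Suc n) \<Longrightarrow> c \<in> W (Suc n) \<Longrightarrow> a + b + c \<in> W n" for a b c n
    using W(3)[of n] by (auto simp: Q_def)
  have "W (Suc n) \<subseteq> W n" for n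
    using cube_W[of 0 n _ 0] zero_W by auto
  then have decr_W: "m \<le> n \<Longrightarrow> W n \<subseteq> W m" for m n
    by (rule lift_Suc_antimono_le)

  define wt where "wt = (\<lambda>x::nat \<times> 'g. (1/2::real) ^ fst x)"
  define weight where "weight xs = (\<Sum>x\<leftarrow>xs. wt x)" for xs
  define val where "val xs = (\<Sum>x\<leftarrow>xs. snd x)" for xs :: "(nat \<times> 'g) list"
  define words where "words = {xs. \<forall>x\<in>set xs. snd x \<in> W (fst x)}"
  (* Cutting a word of weight below (1/2)^m at one letter leaves two parts of weight
     below (1/2)^(m+1); induction puts both into W (m+1), and the letter lies there as well. *)
  have chain: "xs \<in> words \<Longrightarrow> weight xs < (1/2) ^ m \<Longrightarrow> val xs \<in> W m" for xs m
  proof (induction "length xs" arbitrary: xs m rule: less_induct)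
    case less
    show ?case
    proof (cases "xs = []")
      case True
      then show ?thesis by (simp add: val_def zero_W)
    next
      case False
      obtain ys x zs where xs: "xs = ys @ x # zs"
        and small: "weight ys < (1/2) ^ Suc m" "weight zs < (1/2) ^ Suc m"
        using split_at_weight[of wt xs "(1/2) ^ Suc m" "(1/2) ^ Suc m"] False less.prems(2)
        by (auto simp: weight_def wt_def)
      have "weight xs = weight ys + wt x + weight zs" by (simp add: xs weight_def)
      moreover have "0 \<le> weight ys" "0 \<le> weight zs"
        by (auto simp: weight_def wt_def intro!: sum_list_nonneg)
      ultimately have "(1/2::real) ^ fst x < (1/2) ^ m" using less.prems(2) unfolding wt_def by linarith
      then have "Suc m \<le> fst x"
        using power_decreasing[of "fst x" m "1/2::real"] by (simp add: not_less_eq_eq)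
      moreover have "ys \<in> words" "zs \<in> words" "snd x \<in> W (fst x)"
        using less.prems(1) by (auto simp: xs words_def)
      ultimately have "val ys \<in> W (Suc m)" "snd x \<in> W (Suc m)" "val zs \<in> W (Suc m)"
        using less.hyps[of ys "Suc m"] less.hyps[of zs "Suc m"] small decr_W[of "Suc m" "fst x"]
        by (auto simp: xs)
      then have "val ys + snd x + val zs \<in> W m" by (rule cube_W)
      then show ?thesis by (simp add: xs val_def add.assoc)
    qed
  qed

  define l where "l g = Inf (weight ` {xs \<in> words. val xs = g})" for g
  have weight_nonneg: "0 \<le> weight xs" for xs
    by (auto simp: weight_def wt_def intro!: sum_list_nonneg)
  have l_le: "l (val xs) \<le> weight xs" if "xs \<in> words" for xs
    unfolding l_def using that weight_nonneg by (intro cInf_lower bdd_belowI[of _ 0]) auto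
  have ne: "weight ` {xs \<in> words. val xs = g} \<noteq> {}" for g
  proof -
    have "[(0, g)] \<in> {xs \<in> words. val xs = g}" by (simp add: words_def val_def W)
    then show ?thesis by blast
  qed
  have l_approx: "\<exists>xs\<in>words. val xs = g \<and> weight xs < r" if "l g < r" for g r
    using cInf_lessD[OF ne that[unfolded l_def]] by auto
  have add: "l (g + h) \<le> l g + l h" for g h
  proof (rule field_le_epsilon)
    fix e :: real assume "0 < e"
    then obtain xs ys where xs: "xs \<in> words" "val xs = g" "weight xs < l g + e/2"
      and ys: "ys \<in> words" "val ys = h" "weight ys < l h + e/2"
      using l_approx[of g "l g + e/2"] l_approx[of h "l h + e/2"] by auto
    have "l (g + h) \<le> weight (xs @ ys)"
      using l_le[of "xs @ ys"] xs ys by (auto simp: words_def val_def)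
    then show "l (g + h) \<le> l g + l h + e" using xs ys by (simp add: weight_def)
  qed
  have minus_le: "l (- g) \<le> l g" for g
  proof (rule field_le_epsilon)
    fix e :: real assume "0 < e"
    then obtain xs where xs: "xs \<in> words" "val xs = g" "weight xs < l g + e"
      using l_approx[of g "l g + e"] by auto
    define ys where "ys = rev (map (\<lambda>x. (fst x, - snd x)) xs)"
    have "val ys = - val xs"
      unfolding ys_def val_def by (induction xs) (auto simp: minus_add)
    moreover have "weight ys = weight xs"
      by (simp add: ys_def weight_def wt_def rev_map[symmetric] o_def sum_list_rev)
    moreover have "ys \<in> words" using xs(1) minus_W by (auto simp: ys_def words_def)
    ultimately show "l (- g) \<le> l g + e" using l_le[of ys] xs by simp
  qed
  have "group_length l"
  proof
    show "l (g + h) \<le> l g + l h" for g h by (rule add)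
    show "l (- g) = l g" for g using minus_le[of g] minus_le[of "- g"] by simp
    have "0 \<le> l 0" unfolding l_def using ne weight_nonneg by (intro cInf_greatest) auto
    then show "l 0 = 0" using l_le[of "[]"] by (simp add: words_def val_def weight_def)
  next
    fix e :: real assume "0 < e"
    then obtain n where n: "(1/2) ^ n < e" using real_arch_pow_inv[of e "1/2"] by auto
    have "l g < e" if "g \<in> W n" for g
      using l_le[of "[(n, g)]"] that n by (simp add: words_def val_def weight_def wt_def)
    then show "eventually (\<lambda>g. l g < e) (nhds 0)"
      unfolding eventually_nhds using open_W[of n] zero_W[of n] by blast
  qed
  moreover have "g \<in> U" if "l g < 1/2" for g
  proof -
    obtain xs where "xs \<in> words" "val xs = g" "weight xs < (1/2) ^ 1"
      using l_approx[of g "(1/2) ^ 1"] \<open>l g < 1/2\<close> by auto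
    then have "g \<in> W 1" using chain[of xs 1] by simp
    then show ?thesis using W(3)[of 0] by (auto simp: Q_def)
  qed
  ultimately show ?thesis by blast
qed

section \<open>Fixed points of precompact groups\<close>

context real_normed_space
begin

text \<open>
  Barycentres are built from midpoints alone, which avoids sums indexed by finite sets in a
  space given by a carrier.
\<close>

definition half_sum :: "'v \<Rightarrow> 'v \<Rightarrow> 'v" where
  "half_sum x y = (1/2) \<odot>\<^bsub>E\<^esub> x \<oplus>\<^bsub>E\<^esub> (1/2) \<odot>\<^bsub>E\<^esub> y"

lemma smult_in_carrier: "x \<in> carrier E \<Longrightarrow> a \<odot>\<^bsub>E\<^esub> x \<in> carrier E"
  using smult_closed[of a x] by (simp add: real_ring_def)

lemma half_sum_in_carrier:
  "x \<in> carrier E \<Longrightarrow> y \<in> carrier E \<Longrightarrow> half_sum x y \<in> carrier E"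
  by (simp add: half_sum_def smult_in_carrier)

lemma half_sum_self: "x \<in> carrier E \<Longrightarrow> half_sum x x = x"
  using smult_l_distr[of "1/2" "1/2" x] smult_one[of x] by (simp add: half_sum_def real_ring_def)

lemma ndist_half_sum_le:
  assumes "x \<in> carrier E" "y \<in> carrier E" "z \<in> carrier E" "w \<in> carrier E"
  shows "ndist (half_sum x y) (half_sum z w) \<le> (ndist x z + ndist y w) / 2"
proof -
  have smult_diff: "(1/2) \<odot>\<^bsub>E\<^esub> (a \<oplus>\<^bsub>E\<^esub> \<ominus>\<^bsub>E\<^esub> b) = (1/2) \<odot>\<^bsub>E\<^esub> a \<oplus>\<^bsub>E\<^esub> \<ominus>\<^bsub>E\<^esub> ((1/2) \<odot>\<^bsub>E\<^esub> b)"
    if "a \<in> carrier E" "b \<in> carrier E" for a b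
    using that smult_r_distr[of "1/2" a "\<ominus>\<^bsub>E\<^esub> b"] smult_r_minus[of "1/2" b]
    by (simp add: real_ring_def)
  have "half_sum x y \<ominus>\<^bsub>E\<^esub> half_sum z w = (1/2) \<odot>\<^bsub>E\<^esub> (x \<ominus>\<^bsub>E\<^esub> z) \<oplus>\<^bsub>E\<^esub> (1/2) \<odot>\<^bsub>E\<^esub> (y \<ominus>\<^bsub>E\<^esub> w)"
    using assms
    by (simp add: smult_diff half_sum_def smult_in_carrier M.minus_eq M.minus_add M.a_ac)
  then have "ndist (half_sum x y) (half_sum z w)
      = N ((1/2) \<odot>\<^bsub>E\<^esub> (x \<ominus>\<^bsub>E\<^esub> z) \<oplus>\<^bsub>E\<^esub> (1/2) \<odot>\<^bsub>E\<^esub> (y \<ominus>\<^bsub>E\<^esub> w))"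
    using assms by (simp add: ndist_def half_sum_in_carrier)
  also have "\<dots> \<le> (N (x \<ominus>\<^bsub>E\<^esub> z) + N (y \<ominus>\<^bsub>E\<^esub> w)) / 2"
    using assms norm_triangle[of "(1/2) \<odot>\<^bsub>E\<^esub> (x \<ominus>\<^bsub>E\<^esub> z)" "(1/2) \<odot>\<^bsub>E\<^esub> (y \<ominus>\<^bsub>E\<^esub> w)"]
    by (simp add: smult_in_carrier norm_smult)
  finally show ?thesis using assms by (simp add: ndist_def)
qed

lemma ndist_to_half_sum_le:
  assumes "p \<in> carrier E" "x \<in> carrier E" "y \<in> carrier E"
  shows "ndist p (half_sum x y) \<le> (ndist p x + ndist p y) / 2"
  using ndist_half_sum_le[OF assms(1,1,2,3)] by (simp add: half_sum_self assms)

text \<open>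
  An iterated midpoint \<open>z\<close> of the points of \<open>H\<close> gives each of them a weight of at least
  \<open>(1/2) ^ card H\<close>. A point \<open>p\<close> within \<open>r\<close> of all of them and within \<open>r / 2\<close> of one of them
  is therefore closer to \<open>z\<close> than \<open>r\<close> by a definite factor, which depends on \<open>card H\<close> only.
\<close>

lemma exists_barycentre:
  assumes "finite H" "H \<noteq> {}" "H \<subseteq> K" "K \<subseteq> carrier E"
    and K: "\<And>x y. x \<in> K \<Longrightarrow> y \<in> K \<Longrightarrow> half_sum x y \<in> K"
  shows "\<exists>z\<in>K. \<forall>p\<in>carrier E. \<forall>r. (\<forall>c\<in>H. ndist p c \<le> r) \<longrightarrow> ndist p z \<le> r \<and>
     ((\<exists>c\<in>H. ndist p c \<le> r / 2) \<longrightarrow> ndist p z \<le> (1 - (1/2) ^ card H) * r)"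
  using assms(1-3)
proof (induction H rule: finite_ne_induct)
  case (singleton c)
  then show ?case by (intro bexI[of _ c]) auto
next
  case (insert c H)
  define good where "good z \<longleftrightarrow> (\<forall>p\<in>carrier E. \<forall>r. (\<forall>c\<in>H. ndist p c \<le> r) \<longrightarrow> ndist p z \<le> r \<and>
     ((\<exists>c\<in>H. ndist p c \<le> r / 2) \<longrightarrow> ndist p z \<le> (1 - (1/2) ^ card H) * r))" for z
  have "H \<subseteq> K" using insert.prems by blast
  then obtain z where z: "z \<in> K" "good z" using insert.IH unfolding good_def by blast
  have near: "ndist p z \<le> r" if "p \<in> carrier E" "\<forall>c\<in>H. ndist p c \<le> r" for p r
    using z(2) that unfolding good_def by blast
  have nearer: "ndist p z \<le> (1 - (1/2) ^ card H) * r"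
    if "p \<in> carrier E" "\<forall>c\<in>H. ndist p c \<le> r" "\<exists>c\<in>H. ndist p c \<le> r / 2" for p r
    using z(2) that unfolding good_def by blast
  have mem: "c \<in> carrier E" "z \<in> carrier E" using insert.prems assms(4) z(1) by auto
  show ?case
  proof (intro bexI[of _ "half_sum c z"] ballI allI impI conjI)
    show "half_sum c z \<in> K" using insert.prems z(1) K by auto
    fix p r assume p: "p \<in> carrier E" and r: "\<forall>c'\<in>insert c H. ndist p c' \<le> r"
    then have le: "ndist p c \<le> r" "ndist p z \<le> r" using near by auto
    have avg: "ndist p (half_sum c z) \<le> (ndist p c + ndist p z) / 2"
      using ndist_to_half_sum_le p mem by blast
    then show "ndist p (half_sum c z) \<le> r" using le by simp
    have "0 \<le> r" using le metric.nonneg[of p c] by linarith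
    have card: "card (insert c H) = Suc (card H)" using insert.hyps by simp
    assume ex: "\<exists>c'\<in>insert c H. ndist p c' \<le> r / 2"
    show "ndist p (half_sum c z) \<le> (1 - (1/2) ^ card (insert c H)) * r"
    proof (cases "ndist p c \<le> r / 2")
      case True
      have "(1/2::real) ^ card H \<le> (1/2) ^ 1"
        using insert.hyps by (intro power_decreasing) (auto simp: Suc_le_eq card_gt_0_iff)
      then have "(1/2) ^ card H * r \<le> (1/2) * r" using \<open>0 \<le> r\<close> by (intro mult_right_mono) auto
      then show ?thesis using True le avg unfolding card by (simp add: algebra_simps)
    next
      case False
      then have "ndist p z \<le> (1 - (1/2) ^ card H) * r" using ex nearer p r by auto
      then show ?thesis using le avg unfolding card by (simp add: algebra_simps)
    qed
  qed
qed

end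

context continuous_affine_isometric_action
begin

lemma act_in_carrier: "x \<in> carrier E \<Longrightarrow> \<phi> g x \<in> carrier E"
  using affine_isometry[of g] by (auto simp: affine_isometries_def)

lemma ndist_act: "x \<in> carrier E \<Longrightarrow> y \<in> carrier E \<Longrightarrow> ndist (\<phi> g x) (\<phi> g y) = ndist x y"
  using affine_isometry[of g] by (simp add: affine_isometries_def)

lemma act_half_sum:
  assumes "x \<in> carrier E" "y \<in> carrier E"
  shows "\<phi> g (half_sum x y) = half_sum (\<phi> g x) (\<phi> g y)"
proof -
  have "\<forall>t. \<phi> g (((1 - t) \<odot>\<^bsub>E\<^esub> x) \<oplus>\<^bsub>E\<^esub> (t \<odot>\<^bsub>E\<^esub> y)) = ((1 - t) \<odot>\<^bsub>E\<^esub> \<phi> g x) \<oplus>\<^bsub>E\<^esub> (t \<odot>\<^bsub>E\<^esub> \<phi> g y)"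
    using affine_isometry[of g] assms by (simp add: affine_isometries_def)
  from spec[OF this, of "1/2"] show ?thesis by (simp add: half_sum_def)
qed

lemma ndist_act_left:
  assumes "x \<in> carrier E" "y \<in> carrier E"
  shows "ndist (\<phi> g x) y = ndist x (\<phi> (- g) y)"
  using ndist_act[of x "\<phi> (- g) y" g] action_add[of y g "- g"] action_zero[of y] assms
  by (simp add: act_in_carrier)

lemma orbit_map_continuous_at_zero:
  assumes "x \<in> carrier E" "0 < e"
  shows "eventually (\<lambda>g. ndist (\<phi> g x) x < e) (nhds 0)"
proof -
  have "continuous_map euclidean (prod_topology euclidean metric.mtopology) (\<lambda>g::'g. (g, x))"
    using assms by (intro continuous_map_pairedI) auto
  from continuous_map_compose[OF this jointly_continuous]
  have "continuous_map euclidean metric.mtopology (\<lambda>g. \<phi> g x)" by (simp add: o_def)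
  with assms(2) have "\<exists>U. openin euclidean U \<and> 0 \<in> U \<and> (\<forall>g\<in>U. \<phi> g x \<in> metric.mball (\<phi> 0 x) e)"
    unfolding metric.continuous_map_to_metric by simp
  then obtain U where U: "openin euclidean U" "0 \<in> U" "\<forall>g\<in>U. \<phi> g x \<in> metric.mball (\<phi> 0 x) e"
    by blast
  have "open U" using U(1) by (simp only: open_openin)
  have "\<forall>g\<in>U. ndist (\<phi> g x) x < e"
    using U(3) assms(1) by (simp add: action_zero metric.in_mball metric.commute)
  then show ?thesis
    unfolding eventually_nhds using \<open>open U\<close> U(2) by (intro exI[of _ U]) simp
qed

lemma orbit_finite_net:
  assumes "precompact_group TYPE('g)" "x \<in> carrier E" "0 < e"
  shows "\<exists>F. finite F \<and> (\<forall>g. \<exists>f\<in>F. ndist (\<phi> g x) (\<phi> f x) < e)"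
proof -
  define V where "V = {v. ndist (\<phi> v x) x < e}"
  have "0 \<in> interior V"
    using orbit_map_continuous_at_zero[OF assms(2,3)]
    by (auto simp: eventually_nhds V_def interior_def)
  then obtain F where F: "finite F" "F + V = UNIV"
    using assms(1) unfolding precompact_group_def by blast
  have "\<exists>f\<in>F. ndist (\<phi> g x) (\<phi> f x) < e" for g
  proof -
    have "g \<in> F + V" using F by simp
    then obtain f v where "f \<in> F" "v \<in> V" "g = f + v" by (auto simp: set_plus_def)
    then show ?thesis
      using assms(2) by (intro bexI[of _ f]) (auto simp: action_add ndist_act act_in_carrier V_def)
  qed
  then show ?thesis using F(1) by blast
qed

text \<open>
  Move a finite net \<open>F\<close> of the orbit by \<open>g\<close> and round the result to \<open>F\<close> again. This gives a
  self-map of \<open>F\<close>, and there are only finitely many of these. Two group elements with the same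
  self-map move all points of the orbit to nearby places, so one representative of each self-map
  is enough.
\<close>

lemma finite_net_uniform_on_orbit:
  assumes "precompact_group TYPE('g)" "x \<in> carrier E" "0 < e"
  shows "\<exists>H. finite H \<and> (\<forall>g. \<exists>h\<in>H. \<forall>k. ndist (\<phi> (g + k) x) (\<phi> (h + k) x) \<le> e)"
proof -
  obtain F where F: "finite F" "\<And>g. \<exists>f\<in>F. ndist (\<phi> g x) (\<phi> f x) < e / 4"
    using orbit_finite_net[OF assms(1,2), of "e / 4"] assms(3) by auto
  have "\<forall>g. \<exists>f. f \<in> F \<and> ndist (\<phi> g x) (\<phi> f x) < e / 4" using F(2) by blast
  then obtain a where a: "\<And>g. a g \<in> F" "\<And>g. ndist (\<phi> g x) (\<phi> (a g) x) < e / 4"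
    by metis
  define \<sigma> where "\<sigma> g = restrict (\<lambda>f. a (g + f)) F" for g
  have "range \<sigma> \<subseteq> F \<rightarrow>\<^sub>E F" using a(1) by (auto simp: \<sigma>_def)
  then have "finite (range \<sigma>)" using F(1) by (meson finite_PiE finite_subset)
  then obtain H where H: "finite H" "range \<sigma> = \<sigma> ` H"
    using finite_subset_image[of "range \<sigma>" \<sigma> UNIV] by auto
  have "\<exists>h\<in>H. \<forall>k. ndist (\<phi> (g + k) x) (\<phi> (h + k) x) \<le> e" for g
  proof -
    obtain h where h: "h \<in> H" "\<sigma> g = \<sigma> h" using H(2) by blast
    have "ndist (\<phi> (g + k) x) (\<phi> (h + k) x) \<le> e" for k
    proof -
      define f where "f = a k"
      have f: "f \<in> F" "ndist (\<phi> k x) (\<phi> f x) < e / 4" using a by (auto simp: f_def)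
      define c where "c = a (g + f)"
      have c: "c = a (h + f)" using fun_cong[OF h(2), of f] f(1) by (simp add: \<sigma>_def c_def)
      have near: "ndist (\<phi> (u + k) x) (\<phi> c x) < e / 2" if "c = a (u + f)" for u
      proof -
        have "ndist (\<phi> (u + k) x) (\<phi> (u + f) x) < e / 4"
          using f(2) assms(2) by (simp add: action_add ndist_act act_in_carrier)
        moreover have "ndist (\<phi> (u + f) x) (\<phi> c x) < e / 4" using a(2) that by simp
        ultimately show ?thesis
          using metric.triangle[of "\<phi> (u + k) x" "\<phi> (u + f) x" "\<phi> c x"] assms(2)
          by (simp add: act_in_carrier)
      qed
      show ?thesis
        using near[OF c_def] near[OF c] assms(2)
          metric.triangle[of "\<phi> (g + k) x" "\<phi> c x" "\<phi> (h + k) x"]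
        by (simp add: act_in_carrier metric.commute)
    qed
    then show ?thesis using h(1) by blast
  qed
  then show ?thesis using H(1) by blast
qed

text \<open>
  A substitute for the closed convex hull of the orbit of \<open>x\<close>: the points on which any two group
  elements differ no more than they do on the orbit. It has the properties of the hull that
  matter, namely invariance, convexity and uniform approximation by finitely many group elements.
\<close>

definition controlled_by :: "'v \<Rightarrow> 'v set" where
  "controlled_by x = {y \<in> carrier E. \<forall>g h d. (\<forall>k. ndist (\<phi> (g + k) x) (\<phi> (h + k) x) \<le> d)
     \<longrightarrow> ndist (\<phi> g y) (\<phi> h y) \<le> d}"

lemma controlled_by_in_carrier: "y \<in> controlled_by x \<Longrightarrow> y \<in> carrier E"
  by (simp add: controlled_by_def)

lemma controlled_byD:
  assumes "y \<in> controlled_by x" "\<And>k. ndist (\<phi> (g + k) x) (\<phi> (h + k) x) \<le> d"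
  shows "ndist (\<phi> g y) (\<phi> h y) \<le> d"
  using assms unfolding controlled_by_def by blast

lemma controlled_by_self: "x \<in> carrier E \<Longrightarrow> x \<in> controlled_by x"
  unfolding controlled_by_def by (auto dest: spec[of _ 0])

lemma controlled_by_act:
  assumes "y \<in> controlled_by x"
  shows "\<phi> k y \<in> controlled_by x"
proof -
  have "ndist (\<phi> g (\<phi> k y)) (\<phi> h (\<phi> k y)) \<le> d"
    if "\<forall>j. ndist (\<phi> (g + j) x) (\<phi> (h + j) x) \<le> d" for g h d
    using controlled_byD[OF assms, of "g + k" "h + k" d] that assms
    by (simp add: action_add add.assoc controlled_by_def)
  then show ?thesis
    using assms by (auto simp: controlled_by_def act_in_carrier)
qed

lemma controlled_by_half_sum:
  assumes "y \<in> controlled_by x" "z \<in> controlled_by x"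
  shows "half_sum y z \<in> controlled_by x"
proof -
  have mem: "y \<in> carrier E" "z \<in> carrier E" using assms by (auto simp: controlled_by_def)
  have "ndist (\<phi> g (half_sum y z)) (\<phi> h (half_sum y z)) \<le> d"
    if "\<forall>j. ndist (\<phi> (g + j) x) (\<phi> (h + j) x) \<le> d" for g h d
  proof -
    have "ndist (\<phi> g y) (\<phi> h y) \<le> d" "ndist (\<phi> g z) (\<phi> h z) \<le> d"
      using controlled_byD assms that by blast+
    then show ?thesis
      using ndist_half_sum_le[of "\<phi> g y" "\<phi> g z" "\<phi> h y" "\<phi> h z"] mem
      by (simp add: act_half_sum act_in_carrier)
  qed
  then show ?thesis using mem by (auto simp: controlled_by_def half_sum_in_carrier)
qed

text \<open>
  The intersection of all closed balls that contain the orbit of \<open>y\<close>. Averages of orbit points stay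
  inside, and membership is transitive, so the later members of a sequence of successive averages
  remain in the hull of each earlier one, at a distance from it of at most the diameter of its orbit. That
  makes the sequence Cauchy.
\<close>

definition orbit_hull :: "'v \<Rightarrow> 'v set" where
  "orbit_hull y = {z \<in> carrier E. \<forall>p\<in>carrier E. \<forall>s. (\<forall>g. ndist p (\<phi> g y) \<le> s) \<longrightarrow> ndist p z \<le> s}"

lemma orbit_hullD:
  assumes "z \<in> orbit_hull y" "p \<in> carrier E" "\<And>g. ndist p (\<phi> g y) \<le> s"
  shows "ndist p z \<le> s"
  using assms unfolding orbit_hull_def by blast

lemma act_in_orbit_hull: "y \<in> carrier E \<Longrightarrow> \<phi> g y \<in> orbit_hull y"
  by (simp add: orbit_hull_def act_in_carrier)

lemma orbit_hull_half_sum: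
  assumes "z \<in> orbit_hull y" "w \<in> orbit_hull y"
  shows "half_sum z w \<in> orbit_hull y"
proof -
  have mem: "z \<in> carrier E" "w \<in> carrier E" using assms by (auto simp: orbit_hull_def)
  have "ndist p (half_sum z w) \<le> s" if "p \<in> carrier E" "\<forall>g. ndist p (\<phi> g y) \<le> s" for p s
    using ndist_to_half_sum_le[OF that(1) mem] orbit_hullD[OF assms(1) that(1), of s]
      orbit_hullD[OF assms(2) that(1), of s] that(2) by simp
  then show ?thesis using mem by (auto simp: orbit_hull_def half_sum_in_carrier)
qed

lemma orbit_hull_trans:
  assumes "y \<in> carrier E" "z \<in> orbit_hull y" "w \<in> orbit_hull z"
  shows "w \<in> orbit_hull y"
proof -
  have mem: "z \<in> carrier E" "w \<in> carrier E" using assms by (auto simp: orbit_hull_def)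
  have "ndist p w \<le> s" if p: "p \<in> carrier E" "\<forall>g. ndist p (\<phi> g y) \<le> s" for p s
  proof (rule orbit_hullD[OF assms(3) p(1)])
    fix g
    have "ndist (\<phi> (- g) p) z \<le> s"
    proof (rule orbit_hullD[OF assms(2)])
      show "ndist (\<phi> (- g) p) (\<phi> h y) \<le> s" for h
        using p assms(1) by (simp add: ndist_act_left act_in_carrier flip: action_add)
    qed (simp add: p act_in_carrier)
    then show "ndist p (\<phi> g z) \<le> s" using p(1) mem by (simp add: ndist_act_left)
  qed
  then show ?thesis using mem by (simp add: orbit_hull_def)
qed

definition orbit_diameter_le :: "'v \<Rightarrow> real \<Rightarrow> bool" where
  "orbit_diameter_le y r \<longleftrightarrow> (\<forall>g h. ndist (\<phi> g y) (\<phi> h y) \<le> r)"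

text \<open>
  The factor \<open>q\<close> is found before the point \<open>y\<close>, from a finite set \<open>H\<close> that works for all
  controlled points. Therefore the contraction can be repeated as long as the diameter is at
  least \<open>e\<close>. The centres to be averaged are the points \<open>\<phi> h y\<close> for \<open>h\<close> in \<open>H\<close>.
\<close>

lemma orbit_diameter_contraction:
  assumes "precompact_group TYPE('g)" "x \<in> carrier E" "0 < e"
  shows "\<exists>q. 0 \<le> q \<and> q < 1 \<and> (\<forall>y\<in>controlled_by x. \<forall>r\<ge>e. orbit_diameter_le y r \<longrightarrow>
           (\<exists>z\<in>controlled_by x \<inter> orbit_hull y. orbit_diameter_le z (q * r)))"
proof -
  obtain H where H: "finite H" "\<And>g. \<exists>h\<in>H. \<forall>k. ndist (\<phi> (g + k) x) (\<phi> (h + k) x) \<le> e / 2"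
    using finite_net_uniform_on_orbit[OF assms(1,2), of "e / 2"] assms(3) by auto
  define q where "q = 1 - (1/2::real) ^ card H"
  have q: "0 \<le> q" "q < 1" by (auto simp: q_def power_le_one)
  have "\<exists>z\<in>controlled_by x \<inter> orbit_hull y. orbit_diameter_le z (q * r)"
    if y: "y \<in> controlled_by x" and "e \<le> r" and r: "orbit_diameter_le y r" for y r
  proof -
    have memy: "y \<in> carrier E" using y by (rule controlled_by_in_carrier)
    define Y where "Y = (\<lambda>h. \<phi> h y) ` H"
    have "finite Y" "Y \<noteq> {}" using H by (auto simp: Y_def)
    moreover have "Y \<subseteq> controlled_by x \<inter> orbit_hull y"
      using controlled_by_act[OF y] act_in_orbit_hull[OF memy] by (auto simp: Y_def)
    moreover have "controlled_by x \<inter> orbit_hull y \<subseteq> carrier E" by (auto simp: orbit_hull_def)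
    ultimately obtain z where z: "z \<in> controlled_by x \<inter> orbit_hull y"
      and bary: "\<forall>p\<in>carrier E. \<forall>r. (\<forall>c\<in>Y. ndist p c \<le> r) \<longrightarrow> ndist p z \<le> r \<and>
        ((\<exists>c\<in>Y. ndist p c \<le> r / 2) \<longrightarrow> ndist p z \<le> (1 - (1/2) ^ card Y) * r)"
      using exists_barycentre[of Y "controlled_by x \<inter> orbit_hull y"]
        controlled_by_half_sum orbit_hull_half_sum by (metis IntE IntI)
    have near: "ndist p z \<le> r" if "p \<in> carrier E" "\<forall>c\<in>Y. ndist p c \<le> r" for p r
      using bary that by blast
    have nearer: "ndist p z \<le> (1 - (1/2) ^ card Y) * r"
      if "p \<in> carrier E" "\<forall>c\<in>Y. ndist p c \<le> r" "\<exists>c\<in>Y. ndist p c \<le> r / 2" for p r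
      using bary that by blast
    have memz: "z \<in> carrier E" using z controlled_by_in_carrier by blast
    have "0 \<le> r" using \<open>e \<le> r\<close> assms(3) by simp
    have "(1/2::real) ^ card H \<le> (1/2) ^ card Y"
      using card_image_le[OF H(1)] by (intro power_decreasing) (auto simp: Y_def)
    then have "(1 - (1/2) ^ card Y) * r \<le> q * r"
      using \<open>0 \<le> r\<close> by (intro mult_right_mono) (auto simp: q_def)
    moreover have "ndist (\<phi> g y) z \<le> (1 - (1/2) ^ card Y) * r" for g
    proof (rule nearer)
      show "\<forall>c\<in>Y. ndist (\<phi> g y) c \<le> r" using r by (auto simp: Y_def orbit_diameter_le_def)
      obtain h where "h \<in> H" "\<forall>k. ndist (\<phi> (g + k) x) (\<phi> (h + k) x) \<le> e / 2" using H(2) by blast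
      then have "ndist (\<phi> g y) (\<phi> h y) \<le> e / 2" using controlled_byD[OF y] by blast
      then show "\<exists>c\<in>Y. ndist (\<phi> g y) c \<le> r / 2"
        using \<open>h \<in> H\<close> \<open>e \<le> r\<close> by (auto simp: Y_def intro!: bexI[of _ h])
    qed (simp add: memy act_in_carrier)
    ultimately have to_orbit: "ndist (\<phi> g y) z \<le> q * r" for g using order_trans by blast
    (* The ball of radius q * r about any translate of z contains the orbit of y, by
       invariance of the distance, hence also the barycentre z. *)
    have "ndist (\<phi> k z) z \<le> q * r" for k
    proof (rule near)
      show "\<forall>c\<in>Y. ndist (\<phi> k z) c \<le> q * r"
        using to_orbit memy memz
        by (auto simp: Y_def ndist_act_left act_in_carrier metric.commute[of z] simp flip: action_add)
    qed (simp add: memz act_in_carrier)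
    then have "ndist (\<phi> g z) (\<phi> h z) \<le> q * r" for g h
      using memz
      by (metis act_in_carrier action_add metric.commute ndist_act_left)
    then show ?thesis using z by (auto simp: orbit_diameter_le_def)
  qed
  then show ?thesis using q by blast
qed

lemma orbit_bounded:
  assumes "precompact_group TYPE('g)" "x \<in> carrier E"
  shows "\<exists>r. orbit_diameter_le x r"
proof -
  obtain F where F: "finite F" "\<And>g. \<exists>f\<in>F. ndist (\<phi> g x) (\<phi> f x) < 1"
    using orbit_finite_net[OF assms, of 1] by auto
  define R where "R = 1 + (\<Sum>f\<in>F. ndist x (\<phi> f x))"
  have R: "ndist x (\<phi> g x) \<le> R" for g
  proof -
    obtain f where f: "f \<in> F" "ndist (\<phi> g x) (\<phi> f x) < 1" using F(2) by blast
    have "ndist x (\<phi> f x) \<le> (\<Sum>f\<in>F. ndist x (\<phi> f x))"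
      using F(1) f(1) metric.nonneg by (intro member_le_sum) auto
    then show ?thesis
      using metric.triangle[of x "\<phi> f x" "\<phi> g x"] f(2) assms(2)
      by (simp add: R_def act_in_carrier metric.commute)
  qed
  have "ndist (\<phi> g x) (\<phi> h x) \<le> R" for g h
    using R[of "- g + h"] assms(2) by (simp add: ndist_act_left act_in_carrier action_add)
  then show ?thesis by (auto simp: orbit_diameter_le_def)
qed

lemma orbit_diameter_small:
  assumes "precompact_group TYPE('g)" "y \<in> controlled_by x" "x \<in> carrier E" "0 < e"
  shows "\<exists>z\<in>controlled_by x \<inter> orbit_hull y. orbit_diameter_le z e"
proof -
  have memy: "y \<in> carrier E" using assms(2) by (rule controlled_by_in_carrier)
  obtain q where q: "0 \<le> q" "q < 1" and step: "\<And>y r. y \<in> controlled_by x \<Longrightarrow> e \<le> r \<Longrightarrow>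
      orbit_diameter_le y r \<Longrightarrow> \<exists>z\<in>controlled_by x \<inter> orbit_hull y. orbit_diameter_le z (q * r)"
    using orbit_diameter_contraction[OF assms(1,3,4)] by blast
  obtain R where R: "orbit_diameter_le y R" using orbit_bounded[OF assms(1) memy] by blast
  have "\<exists>z\<in>controlled_by x \<inter> orbit_hull y. orbit_diameter_le z (max e (q ^ n * R))" for n
  proof (induction n)
    case 0
    have "orbit_diameter_le y (max e (q ^ 0 * R))"
      using R by (auto simp: orbit_diameter_le_def intro: max.coboundedI2)
    moreover have "y \<in> orbit_hull y" using act_in_orbit_hull[OF memy, of 0] by (simp add: action_zero memy)
    ultimately show ?case using assms(2) by blast
  next
    case (Suc n)
    then obtain z where z: "z \<in> controlled_by x" "z \<in> orbit_hull y" "orbit_diameter_le z (max e (q ^ n * R))"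
      by blast
    then obtain w where w: "w \<in> controlled_by x" "w \<in> orbit_hull z" "orbit_diameter_le w (q * max e (q ^ n * R))"
      using step[of z "max e (q ^ n * R)"] by auto
    have "q * max e (q ^ n * R) \<le> max e (q ^ Suc n * R)"
    proof (cases "e \<le> q ^ n * R")
      case True
      then show ?thesis by (simp add: max_def mult.assoc)
    next
      case False
      then have "q * max e (q ^ n * R) = q * e" by simp
      also have "\<dots> \<le> e" using q assms(4) by simp
      also have "\<dots> \<le> max e (q ^ Suc n * R)" by (rule max.cobounded1)
      finally show ?thesis .
    qed
    then have "orbit_diameter_le w (max e (q ^ Suc n * R))"
      using w(3) order_trans unfolding orbit_diameter_le_def by blast
    then show ?case using w(1) orbit_hull_trans[OF memy z(2) w(2)] by blast
  qed
  moreover obtain n where "q ^ n * R \<le> e"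
  proof -
    have "(\<lambda>n. q ^ n * R) \<longlonglongrightarrow> 0 * R"
      using q by (intro tendsto_mult LIMSEQ_realpow_zero tendsto_const)
    then have "eventually (\<lambda>n. q ^ n * R < e) sequentially" using assms(4) by (simp add: order_tendsto_iff)
    then show ?thesis using that by (auto simp: eventually_sequentially intro: less_imp_le)
  qed
  ultimately show ?thesis by (metis max.absorb1)
qed

theorem precompact_imp_fixed_point:
  assumes "precompact_group TYPE('g)"
  shows "\<exists>\<xi>\<in>carrier E. \<forall>g. \<phi> g \<xi> = \<xi>"
proof -
  define x where "x = \<zero>\<^bsub>E\<^esub>"
  have memx: "x \<in> carrier E" by (simp add: x_def)
  have "\<exists>z. \<forall>n. (z n \<in> controlled_by x \<and> orbit_diameter_le (z n) ((1/2) ^ n)) \<and> z (Suc n) \<in> orbit_hull (z n)"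
  proof (rule dependent_nat_choice)
    show "\<exists>z. z \<in> controlled_by x \<and> orbit_diameter_le z ((1/2) ^ 0)"
      using orbit_diameter_small[OF assms controlled_by_self[OF memx] memx, of "(1/2) ^ 0"] by auto
    show "\<exists>w. (w \<in> controlled_by x \<and> orbit_diameter_le w ((1/2) ^ Suc n)) \<and> w \<in> orbit_hull z"
      if "z \<in> controlled_by x \<and> orbit_diameter_le z ((1/2) ^ n)" for z n
      using orbit_diameter_small[OF assms conjunct1[OF that] memx, of "(1/2) ^ Suc n"] by auto
  qed
  then obtain z where z: "\<And>n. z n \<in> controlled_by x" "\<And>n. orbit_diameter_le (z n) ((1/2) ^ n)"
      "\<And>n. z (Suc n) \<in> orbit_hull (z n)" by blast
  have mem: "z n \<in> carrier E" for n using z(1) by (rule controlled_by_in_carrier)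
  have hull: "z (n + k) \<in> orbit_hull (z n)" for n k
  proof (induction k)
    case 0
    then show ?case using act_in_orbit_hull[OF mem, of 0 n] by (simp add: action_zero mem)
  next
    case (Suc k)
    then show ?case using orbit_hull_trans[OF mem Suc z(3)] by simp
  qed
  have close: "ndist (z n) (z m) \<le> (1/2) ^ n" if "n \<le> m" for n m
  proof -
    have "z m \<in> orbit_hull (z n)" using hull[of n "m - n"] that by simp
    then show ?thesis
    proof (rule orbit_hullD[OF _ mem])
      show "ndist (z n) (\<phi> g (z n)) \<le> (1/2) ^ n" for g
        using z(2)[of n] action_zero[OF mem, of n] unfolding orbit_diameter_le_def by metis
    qed
  qed
  have "metric.MCauchy z"
    unfolding metric.MCauchy_def
  proof (intro conjI allI impI)
    show "range z \<subseteq> carrier E" using mem by blast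
    fix e :: real assume "0 < e"
    then obtain K where K: "(1/2) ^ K < e" using real_arch_pow_inv[of e "1/2"] by auto
    have "ndist (z n) (z m) < e" if "K \<le> n" "K \<le> m" for n m
    proof -
      have "ndist (z n) (z m) \<le> (1/2) ^ K" if "K \<le> n" "n \<le> m" for n m
      proof -
        have "(1/2::real) ^ n \<le> (1/2) ^ K" using that(1) by (intro power_decreasing) auto
        then show ?thesis using close[OF that(2)] by linarith
      qed
      then have "ndist (z n) (z m) \<le> (1/2) ^ K"
        using \<open>K \<le> n\<close> \<open>K \<le> m\<close> metric.commute by (metis nat_le_linear)
      then show ?thesis using K by simp
    qed
    then show "\<exists>K. \<forall>n m. K \<le> n \<longrightarrow> K \<le> m \<longrightarrow> ndist (z n) (z m) < e" by blast
  qed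
  then obtain \<xi> where "limitin metric.mtopology z \<xi> sequentially"
    using complete unfolding metric.mcomplete_def by blast
  then have \<xi>: "\<xi> \<in> carrier E" "\<And>e. 0 < e \<Longrightarrow> \<exists>K. \<forall>n\<ge>K. ndist (z n) \<xi> < e"
    unfolding metric.limit_metric_sequentially by (blast, blast)
  have "\<phi> g \<xi> = \<xi>" for g
  proof -
    have "ndist (\<phi> g \<xi>) \<xi> \<le> e" if "0 < e" for e
    proof -
      obtain K where K: "\<forall>n\<ge>K. ndist (z n) \<xi> < e / 3" using \<xi>(2)[of "e / 3"] \<open>0 < e\<close> by auto
      obtain L where L: "(1/2) ^ L < e / 3" using real_arch_pow_inv[of "e / 3" "1/2"] \<open>0 < e\<close> by auto
      define n where "n = max K L"
      have "(1/2::real) ^ n \<le> (1/2) ^ L" by (intro power_decreasing) (auto simp: n_def)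
      then have "ndist (\<phi> g (z n)) (\<phi> 0 (z n)) < e / 3"
        using z(2)[of n] L unfolding orbit_diameter_le_def by (meson le_less_trans order_trans)
      moreover have "ndist (z n) \<xi> < e / 3" using K by (simp add: n_def)
      moreover from this have "ndist (\<phi> g \<xi>) (\<phi> g (z n)) < e / 3"
        using \<xi>(1) mem by (simp add: ndist_act metric.commute)
      ultimately show ?thesis
        using metric.triangle[of "\<phi> g \<xi>" "\<phi> g (z n)" \<xi>] metric.triangle[of "\<phi> g (z n)" "z n" \<xi>]
        by (simp add: act_in_carrier mem \<xi>(1) action_zero)
    qed
    then have "ndist (\<phi> g \<xi>) \<xi> \<le> 0" by (rule field_le_epsilon[where y=0, simplified])
    then show ?thesis
      using metric.nonneg[of "\<phi> g \<xi>" \<xi>] metric.zero[of "\<phi> g \<xi>" \<xi>] \<xi>(1)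
      by (simp add: act_in_carrier)
  qed
  then show ?thesis using \<xi>(1) by blast
qed

end

section \<open>Banach spaces of bounded functions\<close>

text \<open>
  The space lives in the right summand of a sum type since the points of the spaces under
  consideration are drawn from such a type.
\<close>

definition sup_module :: "('x \<Rightarrow> real) set \<Rightarrow> (real, 'u + ('x \<Rightarrow> real)) module" where
  "sup_module A = \<lparr>carrier = Inr ` A, mult = (\<lambda>S T. S), one = Inr (\<lambda>_. 0), zero = Inr (\<lambda>_. 0),
     add = (\<lambda>S T. Inr (\<lambda>x. projr S x + projr T x)), smult = (\<lambda>a T. Inr (\<lambda>x. a * projr T x))\<rparr>"

definition sup_norm :: "'u + ('x \<Rightarrow> real) \<Rightarrow> real" where
  "sup_norm T = (SUP x. \<bar>projr T x\<bar>)"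

locale uniformly_closed_subspace =
  fixes A :: "('x \<Rightarrow> real) set"
  assumes zero_mem: "(\<lambda>_. 0) \<in> A"
    and add_mem: "S \<in> A \<Longrightarrow> T \<in> A \<Longrightarrow> (\<lambda>x. S x + T x) \<in> A"
    and scale_mem: "T \<in> A \<Longrightarrow> (\<lambda>x. a * T x) \<in> A"
    and bounded: "T \<in> A \<Longrightarrow> bdd_above (range (\<lambda>x. \<bar>T x\<bar>))"
    and limit_mem: "(\<And>n. \<sigma> n \<in> A) \<Longrightarrow> uniform_limit UNIV \<sigma> T sequentially \<Longrightarrow> T \<in> A"
begin

lemma sup_norm_le_iff:
  assumes "T \<in> A"
  shows "sup_norm (Inr T :: 'u + ('x \<Rightarrow> real)) \<le> e \<longleftrightarrow> (\<forall>x. \<bar>T x\<bar> \<le> e)"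
  unfolding sup_norm_def using cSUP_le_iff[of UNIV "\<lambda>x. \<bar>T x\<bar>" e] bounded[OF assms] by simp

lemma real_normed_space_sup_module:
  "real_normed_space (sup_module A :: (real, 'u + ('x \<Rightarrow> real)) module) sup_norm"
proof -
  let ?E = "sup_module A :: (real, 'u + ('x \<Rightarrow> real)) module"
  have "cring real_ring"
    by (intro cringI abelian_groupI comm_monoidI)
      (auto simp: real_ring_def algebra_simps intro: exI[of _ "- x" for x])
  moreover have "abelian_group ?E"
  proof (rule abelian_groupI)
    fix X assume "X \<in> carrier ?E"
    then obtain T where T: "X = Inr T" "T \<in> A" by (auto simp: sup_module_def)
    then have "Inr (\<lambda>x. - T x) \<in> carrier ?E" using scale_mem[OF T(2), of "-1"] by (simp add: sup_module_def)
    then show "\<exists>S\<in>carrier ?E. S \<oplus>\<^bsub>?E\<^esub> X = \<zero>\<^bsub>?E\<^esub>"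
      by (rule rev_bexI) (simp add: T sup_module_def)
  qed (auto simp: sup_module_def zero_mem add_mem algebra_simps)
  ultimately interpret module real_ring ?E
    by (rule moduleI) (auto simp: sup_module_def real_ring_def scale_mem algebra_simps)
  have abs_le: "\<bar>T x\<bar> \<le> sup_norm (Inr T :: 'u + ('x \<Rightarrow> real))" if "T \<in> A" for T x
    using sup_norm_le_iff[OF that] by blast
  show ?thesis
  proof
    fix X assume "X \<in> carrier ?E" "sup_norm X = 0"
    then obtain T where T: "X = Inr T" "T \<in> A" by (auto simp: sup_module_def)
    then have "T x = 0" for x using abs_le[OF T(2), of x] \<open>sup_norm X = 0\<close> by simp
    then show "X = \<zero>\<^bsub>?E\<^esub>" using T by (auto simp: sup_module_def)
  next
    fix X a assume "X \<in> carrier ?E"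
    then obtain T where T: "X = Inr T" "T \<in> A" by (auto simp: sup_module_def)
    have scale_le: "sup_norm (Inr (\<lambda>x. c * S x) :: 'u + ('x \<Rightarrow> real)) \<le> \<bar>c\<bar> * sup_norm (Inr S :: 'u + ('x \<Rightarrow> real))"
      if "S \<in> A" for S and c :: real
      unfolding sup_norm_le_iff[OF scale_mem[OF that]]
      using abs_le[OF that] by (simp add: abs_mult mult_left_mono)
    show "sup_norm (a \<odot>\<^bsub>?E\<^esub> X) = \<bar>a\<bar> * sup_norm X"
    proof (cases "a = 0")
      case True
      then show ?thesis by (simp add: sup_module_def sup_norm_def)
    next
      case False
      have "\<bar>a\<bar> * sup_norm X \<le> sup_norm (a \<odot>\<^bsub>?E\<^esub> X)"
        using scale_le[OF scale_mem[OF T(2)], of "1 / a" a] False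
        by (simp add: T sup_module_def field_simps)
      then show ?thesis using scale_le[OF T(2), of a] by (simp add: T sup_module_def)
    qed
  next
    fix X Y assume "X \<in> carrier ?E" "Y \<in> carrier ?E"
    then obtain S T where ST: "X = Inr S" "S \<in> A" "Y = Inr T" "T \<in> A" by (auto simp: sup_module_def)
    have "\<bar>S x + T x\<bar> \<le> sup_norm X + sup_norm Y" for x
      using abs_le[OF ST(2), of x] abs_le[OF ST(4), of x] ST(1,3) by simp
    then show "sup_norm (X \<oplus>\<^bsub>?E\<^esub> Y) \<le> sup_norm X + sup_norm Y"
      by (simp add: sup_norm_le_iff[OF add_mem[OF ST(2,4)]] ST sup_module_def)
  qed
qed

lemma ndist_le_iff:
  assumes "S \<in> A" "T \<in> A"
  shows "real_normed_space.ndist (sup_module A) sup_norm (Inr S :: 'u + ('x \<Rightarrow> real)) (Inr T) \<le> e \<longleftrightarrow>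
    (\<forall>x. \<bar>S x - T x\<bar> \<le> e)"
proof -
  interpret real_normed_space "sup_module A :: (real, 'u + ('x \<Rightarrow> real)) module" sup_norm
    by (rule real_normed_space_sup_module)
  let ?E = "sup_module A :: (real, 'u + ('x \<Rightarrow> real)) module"
  have neg: "(\<lambda>x. - T x) \<in> A" using scale_mem[OF assms(2), of "-1"] by simp
  have "\<ominus>\<^bsub>?E\<^esub> (Inr T :: 'u + ('x \<Rightarrow> real)) = Inr (\<lambda>x. - T x)"
    using neg assms(2) by (intro M.minus_equality) (auto simp: sup_module_def)
  then have "Inr S \<ominus>\<^bsub>?E\<^esub> (Inr T :: 'u + ('x \<Rightarrow> real)) = Inr (\<lambda>x. S x - T x)"
    by (simp add: M.minus_eq) (simp add: sup_module_def)
  moreover have "(\<lambda>x. S x - T x) \<in> A" using add_mem[OF assms(1) neg] by simp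
  ultimately show ?thesis
    using assms sup_norm_le_iff[of "\<lambda>x. S x - T x" e]
    by (simp add: ndist_def) (simp add: sup_module_def)
qed

theorem real_banach_space_sup_module:
  "real_banach_space (sup_module A :: (real, 'u + ('x \<Rightarrow> real)) module) sup_norm"
proof -
  let ?E = "sup_module A :: (real, 'u + ('x \<Rightarrow> real)) module"
  interpret real_normed_space ?E sup_norm by (rule real_normed_space_sup_module)
  have "\<exists>X. limitin metric.mtopology \<sigma> X sequentially" if \<sigma>: "metric.MCauchy \<sigma>" for \<sigma>
  proof -
    have "range \<sigma> \<subseteq> Inr ` A" using \<sigma> by (simp add: metric.MCauchy_def) (simp add: sup_module_def)
    then have "\<forall>n. \<exists>T\<in>A. \<sigma> n = Inr T" by blast
    then obtain \<tau> where \<tau>: "\<And>n. \<tau> n \<in> A" "\<And>n. \<sigma> n = Inr (\<tau> n)" by metis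
    have "uniformly_Cauchy_on UNIV \<tau>"
      unfolding uniformly_Cauchy_on_def
    proof (intro allI impI)
      fix e :: real assume "0 < e"
      then obtain M where M: "\<And>n m. M \<le> n \<Longrightarrow> M \<le> m \<Longrightarrow> ndist (\<sigma> n) (\<sigma> m) < e / 2"
        using \<sigma> unfolding metric.MCauchy_def by (meson half_gt_zero)
      have "\<bar>\<tau> m x - \<tau> n x\<bar> < e" if "M \<le> m" "M \<le> n" for x m n
      proof -
        have "ndist (Inr (\<tau> m)) (Inr (\<tau> n)) \<le> e / 2" using M[OF that] \<tau>(2) by simp
        then have "\<bar>\<tau> m x - \<tau> n x\<bar> \<le> e / 2" using ndist_le_iff[OF \<tau>(1) \<tau>(1)] by blast
        then show ?thesis using \<open>0 < e\<close> by simp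
      qed
      then show "\<exists>M. \<forall>x\<in>UNIV. \<forall>m\<ge>M. \<forall>n\<ge>M. dist (\<tau> m x) (\<tau> n x) < e"
        by (auto simp: dist_real_def intro!: exI[of _ M])
    qed
    then obtain T where T: "uniform_limit UNIV \<tau> T sequentially"
      using Cauchy_uniformly_convergent uniformly_convergent_on_def by blast
    then have "T \<in> A" using limit_mem \<tau>(1) by blast
    have "\<exists>M. \<forall>n\<ge>M. ndist (\<sigma> n) (Inr T) < e" if "0 < e" for e
    proof -
      have "eventually (\<lambda>n. \<forall>x\<in>UNIV. dist (\<tau> n x) (T x) < e / 2) sequentially"
        using T that by (intro uniform_limitD) auto
      then obtain M where M: "\<And>n x. M \<le> n \<Longrightarrow> \<bar>\<tau> n x - T x\<bar> < e / 2"
        by (auto simp: eventually_sequentially dist_real_def)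
      have "ndist (\<sigma> n) (Inr T) < e" if "M \<le> n" for n
      proof -
        have "ndist (Inr (\<tau> n)) (Inr T) \<le> e / 2"
          unfolding ndist_le_iff[OF \<tau>(1) \<open>T \<in> A\<close>] using M[OF that] by (simp add: less_imp_le)
        then show ?thesis using \<open>0 < e\<close> \<tau>(2) by simp
      qed
      then show ?thesis by blast
    qed
    moreover have "Inr T \<in> carrier ?E" "\<And>n. \<sigma> n \<in> carrier ?E"
      using \<open>T \<in> A\<close> \<tau> by (auto simp: sup_module_def)
    ultimately show ?thesis
      unfolding metric.limit_metric_sequentially by (intro exI[of _ "Inr T"]) auto
  qed
  then have "metric.mcomplete" unfolding metric.mcomplete_def by blast
  then show ?thesis
    by (intro real_banach_space.intro real_normed_space_axioms real_banach_space_axioms.intro)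
qed

end

section \<open>Functionals on the Lipschitz functions of a length\<close>

text \<open>
  For an action by isometries, joint continuity reduces to continuity of the orbit maps at the
  identity; a nonexpansive action is isometric because its inverses are nonexpansive too.
\<close>

lemma (in real_banach_space) continuous_affine_isometric_actionI:
  fixes \<phi> :: "'g::{topological_group_add, t2_space} \<Rightarrow> 'a \<Rightarrow> 'a"
  assumes closed: "\<And>g x. x \<in> carrier E \<Longrightarrow> \<phi> g x \<in> carrier E"
    and zero: "\<And>x. x \<in> carrier E \<Longrightarrow> \<phi> 0 x = x"
    and add: "\<And>g h x. x \<in> carrier E \<Longrightarrow> \<phi> (g + h) x = \<phi> g (\<phi> h x)"
    and nonexpansive: "\<And>g x y. x \<in> carrier E \<Longrightarrow> y \<in> carrier E \<Longrightarrow> ndist (\<phi> g x) (\<phi> g y) \<le> ndist x y"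
    and affine: "\<And>g x y t. x \<in> carrier E \<Longrightarrow> y \<in> carrier E \<Longrightarrow>
       \<phi> g (((1 - t) \<odot>\<^bsub>E\<^esub> x) \<oplus>\<^bsub>E\<^esub> (t \<odot>\<^bsub>E\<^esub> y)) = ((1 - t) \<odot>\<^bsub>E\<^esub> \<phi> g x) \<oplus>\<^bsub>E\<^esub> (t \<odot>\<^bsub>E\<^esub> \<phi> g y)"
    and orbit_continuous:
      "\<And>x e. x \<in> carrier E \<Longrightarrow> 0 < e \<Longrightarrow> eventually (\<lambda>g. ndist (\<phi> g x) x < e) (nhds 0)"
  shows "continuous_affine_isometric_action E N \<phi>"
proof -
  have inv: "\<phi> g (\<phi> (- g) x) = x" "\<phi> (- g) (\<phi> g x) = x" if "x \<in> carrier E" for g x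
    using add[of x g "- g"] add[of x "- g" g] zero[of x] that by auto
  have iso: "ndist (\<phi> g x) (\<phi> g y) = ndist x y" if "x \<in> carrier E" "y \<in> carrier E" for g x y
    using nonexpansive[OF that, of g] nonexpansive[of "\<phi> g x" "\<phi> g y" "- g"] that
    by (simp add: closed inv)
  have "\<phi> g ` carrier E = carrier E" for g
    using closed inv(1) by (auto simp: image_iff) metis
  then have "\<phi> g \<in> affine_isometries" for g
    using iso affine by (simp add: affine_isometries_def)
  moreover have "continuous_map (prod_topology euclidean metric.mtopology) metric.mtopology (\<lambda>(g, x). \<phi> g x)"
    unfolding metric.continuous_map_to_metric
  proof (intro ballI allI impI)
    fix p :: "'g \<times> 'a" and e :: real
    assume p: "p \<in> topspace (prod_topology euclidean metric.mtopology)" and "0 < e"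
    obtain g x where gx: "p = (g, x)" by (cases p)
    have x: "x \<in> carrier E" using p gx by simp
    obtain V where V: "open V" "0 \<in> V" "\<And>v. v \<in> V \<Longrightarrow> ndist (\<phi> v x) x < e / 2"
      using orbit_continuous[OF x, of "e / 2"] \<open>0 < e\<close> by (auto simp: eventually_nhds)
    define U where "U = (\<lambda>h. - g + h) -` V"
    have "open U" unfolding U_def by (intro open_vimage V continuous_intros)
    have near: "\<phi> h y \<in> metric.mball (\<phi> g x) e" if "h \<in> U" "y \<in> metric.mball x (e / 2)" for h y
    proof -
      have y: "y \<in> carrier E" "ndist x y < e / 2" using that(2) by (auto simp: metric.in_mball)
      have "ndist (\<phi> (- g + h) x) x < e / 2" using that(1) V(3) by (simp add: U_def)
      then have "ndist (\<phi> g (\<phi> (- g + h) x)) (\<phi> g x) < e / 2" using x by (simp add: iso closed)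
      moreover have "\<phi> g (\<phi> (- g + h) x) = \<phi> h x" using x add[of x g "- g + h"] by (simp add: add.assoc[symmetric])
      moreover have "ndist (\<phi> h x) (\<phi> h y) < e / 2" using x y by (simp add: iso)
      ultimately have "ndist (\<phi> g x) (\<phi> h y) < e"
        using metric.triangle[of "\<phi> g x" "\<phi> h x" "\<phi> h y"] x y
        by (simp add: closed metric.commute)
      then show ?thesis using x y by (simp add: metric.in_mball closed)
    qed
    show "\<exists>U. openin (prod_topology euclidean metric.mtopology) U \<and> p \<in> U \<and>
        (\<forall>q\<in>U. (case q of (g, x) \<Rightarrow> \<phi> g x) \<in> metric.mball (case p of (g, x) \<Rightarrow> \<phi> g x) e)"
    proof (intro exI conjI ballI)
      show "openin (prod_topology euclidean metric.mtopology) (U \<times> metric.mball x (e / 2))"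
        using \<open>open U\<close> by (simp add: openin_prod_Times_iff flip: open_openin)
      show "p \<in> U \<times> metric.mball x (e / 2)"
        using V(2) \<open>0 < e\<close> x by (simp add: gx U_def)
      fix q assume "q \<in> U \<times> metric.mball x (e / 2)"
      then show "(case q of (g, x) \<Rightarrow> \<phi> g x) \<in> metric.mball (case p of (g, x) \<Rightarrow> \<phi> g x) e"
        using near by (auto simp: gx)
    qed
  qed
  ultimately show ?thesis
    using zero add
    by (intro continuous_affine_isometric_action.intro real_banach_space_axioms
        continuous_affine_isometric_action_axioms.intro)
qed

context group_length
begin

definition lipschitz :: "('g \<Rightarrow> real) set" where
  "lipschitz = {f. \<forall>x y. \<bar>f x - f y\<bar> \<le> l (- x + y)}"

lemma lipschitzD: "f \<in> lipschitz \<Longrightarrow> \<bar>f x - f y\<bar> \<le> l (- x + y)"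
  by (simp add: lipschitz_def)

lemma lipschitz_translate: "f \<in> lipschitz \<Longrightarrow> (\<lambda>x. f (g + x)) \<in> lipschitz"
  using lipschitzD[of f "g + x" "g + y" for x y]
  by (auto simp: lipschitz_def minus_add diff_conv_add_uminus add.assoc simp del: add_uminus_conv_diff)

lemma lipschitz_const: "(\<lambda>_. c) \<in> lipschitz"
  by (simp add: lipschitz_def length_nonneg)

lemma lipschitz_add_const: "f \<in> lipschitz \<Longrightarrow> (\<lambda>x. f x + c) \<in> lipschitz"
  by (simp add: lipschitz_def)

lemma lipschitz_truncated_distance:
  assumes "finite S"
  shows "(\<lambda>x. Min (insert c ((\<lambda>s. l (- s + x)) ` S))) \<in> lipschitz" (is "?f \<in> _")
proof -
  have le: "?f x \<le> ?f y + l (- x + y)" for x y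
  proof -
    have "?f y \<in> insert c ((\<lambda>s. l (- s + y)) ` S)" using assms by (intro Min_in) auto
    then consider "?f y = c" | s where "s \<in> S" "?f y = l (- s + y)" by auto
    then show ?thesis
    proof cases
      case 1
      have "?f x \<le> c" using assms by simp
      then show ?thesis using 1 length_nonneg[of "- x + y"] by linarith
    next
      case 2
      have "?f x \<le> l (- s + x)" using assms 2(1) by (intro Min_le) auto
      also have "- s + x = (- s + y) + - (- x + y)" by (simp add: minus_add add.assoc)
      also have "l \<dots> \<le> l (- s + y) + l (- x + y)"
        using length_add[of "- s + y" "- (- x + y)"] unfolding length_minus .
      finally show ?thesis using 2(2) by linarith
    qed
  qed
  have sym: "l (- y + x) = l (- x + y)" for x y
    using length_minus[of "- x + y"] by (simp add: minus_add)
  have "\<bar>?f x - ?f y\<bar> \<le> l (- x + y)" for x y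
    using le[of x y] le[of y x] sym[of y x] by linarith
  then show ?thesis by (simp add: lipschitz_def)
qed

text \<open>
  Uniform continuity with respect to pointwise convergence of Lipschitz functions. It is what
  remains, after uniform limits, of depending on finitely many values of the argument.
\<close>

definition pointwise_uniformly_continuous :: "(('g \<Rightarrow> real) \<Rightarrow> real) \<Rightarrow> bool" where
  "pointwise_uniformly_continuous T \<longleftrightarrow> (\<forall>e>0. \<exists>S d. finite S \<and> 0 < d \<and>
     (\<forall>f\<in>lipschitz. \<forall>h\<in>lipschitz. (\<forall>s\<in>S. \<bar>f s - h s\<bar> \<le> d) \<longrightarrow> \<bar>T f - T h\<bar> \<le> e))"

lemma pointwise_uniformly_continuousE:
  assumes "pointwise_uniformly_continuous T" "0 < e"
  obtains S d where "finite S" "0 < d"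
    "\<And>f h. f \<in> lipschitz \<Longrightarrow> h \<in> lipschitz \<Longrightarrow> (\<And>s. s \<in> S \<Longrightarrow> \<bar>f s - h s\<bar> \<le> d) \<Longrightarrow> \<bar>T f - T h\<bar> \<le> e"
  using assms unfolding pointwise_uniformly_continuous_def by metis

text \<open>
  The evaluation differences \<open>f \<mapsto> f x - f y\<close> belong here, so the space contains a copy of the
  free Banach space (Arens--Eells space) over \<open>G\<close> with the pseudometric \<open>l (- x + y)\<close>. Linearity is
  not demanded: the properties listed here are stable under uniform limits, which makes the space
  complete without forming a closure. The value \<open>0\<close> off the Lipschitz functions turns the supremum
  over all functions into a supremum over the Lipschitz functions.
\<close>

definition lipschitz_functionals :: "(('g \<Rightarrow> real) \<Rightarrow> real) set" where
  "lipschitz_functionals = {T. (\<forall>f. f \<notin> lipschitz \<longrightarrow> T f = 0) \<and> T (\<lambda>_. 0) = 0 \<and>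
     (\<forall>f\<in>lipschitz. \<forall>c. T (\<lambda>x. f x + c) = T f) \<and>
     bdd_above (range (\<lambda>f. \<bar>T f\<bar>)) \<and> pointwise_uniformly_continuous T}"

lemma lipschitz_functionals_closed_subspace: "uniformly_closed_subspace lipschitz_functionals"
proof
  show "(\<lambda>_. 0) \<in> lipschitz_functionals"
    by (auto simp: lipschitz_functionals_def pointwise_uniformly_continuous_def intro!: exI[of _ "{}"] exI[of _ 1])
next
  fix T assume "T \<in> lipschitz_functionals"
  then show "bdd_above (range (\<lambda>f. \<bar>T f\<bar>))" by (simp add: lipschitz_functionals_def)
next
  fix T T' assume T: "T \<in> lipschitz_functionals" and T': "T' \<in> lipschitz_functionals"
  obtain B B' where B: "\<And>f. \<bar>T f\<bar> \<le> B" "\<And>f. \<bar>T' f\<bar> \<le> B'"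
    using T T' unfolding lipschitz_functionals_def bdd_above_def by auto
  have "bdd_above (range (\<lambda>f. \<bar>T f + T' f\<bar>))"
  proof (rule bdd_aboveI2)
    show "\<bar>T f + T' f\<bar> \<le> B + B'" for f using B[of f] by linarith
  qed
  moreover have "pointwise_uniformly_continuous (\<lambda>f. T f + T' f)"
    unfolding pointwise_uniformly_continuous_def
  proof (intro allI impI)
    fix e :: real assume "0 < e"
    then have e: "0 < e / 2" by simp
    have uc: "pointwise_uniformly_continuous T" "pointwise_uniformly_continuous T'"
      using T T' by (auto simp: lipschitz_functionals_def)
    obtain S d where S: "finite S" "0 < d" "\<And>f h. f \<in> lipschitz \<Longrightarrow> h \<in> lipschitz \<Longrightarrow>
        (\<And>s. s \<in> S \<Longrightarrow> \<bar>f s - h s\<bar> \<le> d) \<Longrightarrow> \<bar>T f - T h\<bar> \<le> e / 2"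
      using pointwise_uniformly_continuousE[OF uc(1) e] by blast
    obtain S' d' where S': "finite S'" "0 < d'" "\<And>f h. f \<in> lipschitz \<Longrightarrow> h \<in> lipschitz \<Longrightarrow>
        (\<And>s. s \<in> S' \<Longrightarrow> \<bar>f s - h s\<bar> \<le> d') \<Longrightarrow> \<bar>T' f - T' h\<bar> \<le> e / 2"
      using pointwise_uniformly_continuousE[OF uc(2) e] by blast
    have "\<bar>T f + T' f - (T h + T' h)\<bar> \<le> e"
      if "f \<in> lipschitz" "h \<in> lipschitz" "\<forall>s\<in>S \<union> S'. \<bar>f s - h s\<bar> \<le> min d d'" for f h
    proof -
      have "\<bar>T f - T h\<bar> \<le> e / 2" by (rule S(3)) (use that in auto)
      moreover have "\<bar>T' f - T' h\<bar> \<le> e / 2" by (rule S'(3)) (use that in auto)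
      ultimately show ?thesis by linarith
    qed
    then show "\<exists>S d. finite S \<and> 0 < d \<and> (\<forall>f\<in>lipschitz. \<forall>h\<in>lipschitz.
        (\<forall>s\<in>S. \<bar>f s - h s\<bar> \<le> d) \<longrightarrow> \<bar>T f + T' f - (T h + T' h)\<bar> \<le> e)"
      using S(1,2) S'(1,2) by (intro exI[of _ "S \<union> S'"] exI[of _ "min d d'"]) auto
  qed
  ultimately show "(\<lambda>f. T f + T' f) \<in> lipschitz_functionals" using T T' by (auto simp: lipschitz_functionals_def)
next
  fix T and a :: real assume T: "T \<in> lipschitz_functionals"
  obtain B where B: "\<And>f. \<bar>T f\<bar> \<le> B"
    using T unfolding lipschitz_functionals_def bdd_above_def by auto
  have "bdd_above (range (\<lambda>f. \<bar>a * T f\<bar>))"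
  proof (rule bdd_aboveI2)
    show "\<bar>a * T f\<bar> \<le> \<bar>a\<bar> * B" for f using B[of f] by (simp add: abs_mult mult_left_mono)
  qed
  moreover have "pointwise_uniformly_continuous (\<lambda>f. a * T f)"
    unfolding pointwise_uniformly_continuous_def
  proof (intro allI impI)
    fix e :: real assume "0 < e"
    then have e: "0 < e / (\<bar>a\<bar> + 1)" by simp
    have uc: "pointwise_uniformly_continuous T" using T by (simp add: lipschitz_functionals_def)
    obtain S d where S: "finite S" "0 < d" "\<And>f h. f \<in> lipschitz \<Longrightarrow> h \<in> lipschitz \<Longrightarrow>
        (\<And>s. s \<in> S \<Longrightarrow> \<bar>f s - h s\<bar> \<le> d) \<Longrightarrow> \<bar>T f - T h\<bar> \<le> e / (\<bar>a\<bar> + 1)"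
      using pointwise_uniformly_continuousE[OF uc e] by blast
    have "\<bar>a * T f - a * T h\<bar> \<le> e"
      if "f \<in> lipschitz" "h \<in> lipschitz" "\<forall>s\<in>S. \<bar>f s - h s\<bar> \<le> d" for f h
    proof -
      have "\<bar>T f - T h\<bar> \<le> e / (\<bar>a\<bar> + 1)" by (rule S(3)) (use that in auto)
      then have "\<bar>T f - T h\<bar> * (\<bar>a\<bar> + 1) \<le> e" by (simp add: pos_le_divide_eq)
      moreover have "\<bar>a * T f - a * T h\<bar> = \<bar>T f - T h\<bar> * \<bar>a\<bar>"
        by (simp add: abs_mult flip: right_diff_distrib)
      ultimately show ?thesis by (simp add: distrib_left)
    qed
    then show "\<exists>S d. finite S \<and> 0 < d \<and> (\<forall>f\<in>lipschitz. \<forall>h\<in>lipschitz.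
        (\<forall>s\<in>S. \<bar>f s - h s\<bar> \<le> d) \<longrightarrow> \<bar>a * T f - a * T h\<bar> \<le> e)"
      using S(1,2) by (intro exI[of _ S] exI[of _ d]) auto
  qed
  ultimately show "(\<lambda>f. a * T f) \<in> lipschitz_functionals" using T by (auto simp: lipschitz_functionals_def)
next
  fix \<sigma> T assume \<sigma>: "\<And>n. \<sigma> n \<in> lipschitz_functionals" and lim: "uniform_limit UNIV \<sigma> T sequentially"
  have limf: "(\<lambda>n. \<sigma> n f) \<longlonglongrightarrow> T f" for f using tendsto_uniform_limitI[OF lim] by simp
  have approx: "\<exists>n. \<forall>f. \<bar>\<sigma> n f - T f\<bar> < e" if "0 < e" for e
    using uniform_limitD[OF lim that] by (auto simp: eventually_sequentially dist_real_def)
  have "T f = 0" if "f \<notin> lipschitz" for f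
    using limf[of f] \<sigma> that by (simp add: lipschitz_functionals_def LIMSEQ_const_iff)
  moreover have "T (\<lambda>_. 0) = 0"
    using limf[of "\<lambda>_. 0"] \<sigma> by (simp add: lipschitz_functionals_def LIMSEQ_const_iff)
  moreover have "T (\<lambda>x. f x + c) = T f" if "f \<in> lipschitz" for f c
  proof -
    have "\<sigma> n (\<lambda>x. f x + c) = \<sigma> n f" for n using \<sigma>[of n] that by (simp add: lipschitz_functionals_def)
    then show ?thesis using limf[of "\<lambda>x. f x + c"] limf[of f] by (simp add: LIMSEQ_unique)
  qed
  moreover have "bdd_above (range (\<lambda>f. \<bar>T f\<bar>))"
  proof -
    obtain n where n: "\<And>f. \<bar>\<sigma> n f - T f\<bar> < 1" using approx[of 1] by auto
    obtain B where B: "\<And>f. \<bar>\<sigma> n f\<bar> \<le> B"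
      using \<sigma>[of n] unfolding lipschitz_functionals_def bdd_above_def by auto
    show ?thesis
    proof (rule bdd_aboveI2)
      show "\<bar>T f\<bar> \<le> B + 1" for f using B[of f] n[of f] by linarith
    qed
  qed
  moreover have "pointwise_uniformly_continuous T"
    unfolding pointwise_uniformly_continuous_def
  proof (intro allI impI)
    fix e :: real assume "0 < e"
    then have e: "0 < e / 3" by simp
    obtain n where n: "\<And>f. \<bar>\<sigma> n f - T f\<bar> < e / 3" using approx[OF e] by auto
    have uc: "pointwise_uniformly_continuous (\<sigma> n)" using \<sigma>[of n] by (simp add: lipschitz_functionals_def)
    obtain S d where S: "finite S" "0 < d" "\<And>f h. f \<in> lipschitz \<Longrightarrow> h \<in> lipschitz \<Longrightarrow>
        (\<And>s. s \<in> S \<Longrightarrow> \<bar>f s - h s\<bar> \<le> d) \<Longrightarrow> \<bar>\<sigma> n f - \<sigma> n h\<bar> \<le> e / 3"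
      using pointwise_uniformly_continuousE[OF uc e] by blast
    have "\<bar>T f - T h\<bar> \<le> e"
      if "f \<in> lipschitz" "h \<in> lipschitz" "\<forall>s\<in>S. \<bar>f s - h s\<bar> \<le> d" for f h
    proof -
      have "\<bar>\<sigma> n f - \<sigma> n h\<bar> \<le> e / 3" by (rule S(3)) (use that in auto)
      then show ?thesis using n[of f] n[of h] by linarith
    qed
    then show "\<exists>S d. finite S \<and> 0 < d \<and> (\<forall>f\<in>lipschitz. \<forall>h\<in>lipschitz.
        (\<forall>s\<in>S. \<bar>f s - h s\<bar> \<le> d) \<longrightarrow> \<bar>T f - T h\<bar> \<le> e)"
      using S(1,2) by (intro exI[of _ S] exI[of _ d]) auto
  qed
  ultimately show "T \<in> lipschitz_functionals" by (simp add: lipschitz_functionals_def)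
qed

text \<open>
  Under the identification of \<open>T\<close> with \<open>T + \<delta>\<^sub>0\<close> for the evaluation \<open>\<delta>\<^sub>0\<close> at the identity, this is
  translation: it sends \<open>T + \<delta>\<^sub>0\<close> to \<open>g T + \<delta>\<^sub>g\<close>.
\<close>

definition shift :: "'g \<Rightarrow> (('g \<Rightarrow> real) \<Rightarrow> real) \<Rightarrow> ('g \<Rightarrow> real) \<Rightarrow> real" where
  "shift g T f = (if f \<in> lipschitz then T (\<lambda>x. f (g + x)) + (f g - f 0) else 0)"

lemma abs_increment_le: "f \<in> lipschitz \<Longrightarrow> \<bar>f g - f 0\<bar> \<le> l g"
  using lipschitzD[of f g 0] by (simp add: length_minus)

lemma shift_in_functionals:
  assumes T: "T \<in> lipschitz_functionals"
  shows "shift g T \<in> lipschitz_functionals"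
proof -
  obtain B where B: "\<And>f. \<bar>T f\<bar> \<le> B"
    using T unfolding lipschitz_functionals_def bdd_above_def by auto
  have "bdd_above (range (\<lambda>f. \<bar>shift g T f\<bar>))"
  proof (rule bdd_aboveI2)
    fix f
    have "0 \<le> B" using B[of f] by linarith
    then show "\<bar>shift g T f\<bar> \<le> B + l g"
    proof (cases "f \<in> lipschitz")
      case True
      then show ?thesis
        using B[of "\<lambda>x. f (g + x)"] abs_increment_le[OF True, of g] by (simp add: shift_def)
    next
      case False
      then show ?thesis using \<open>0 \<le> B\<close> length_nonneg[of g] by (simp add: shift_def)
    qed
  qed
  moreover have "shift g T (\<lambda>x. f x + c) = shift g T f" if "f \<in> lipschitz" for f c
    using T lipschitz_translate[OF that, of g] lipschitz_add_const[OF that, of c] that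
    by (simp add: shift_def lipschitz_functionals_def)
  moreover have "pointwise_uniformly_continuous (shift g T)"
    unfolding pointwise_uniformly_continuous_def
  proof (intro allI impI)
    fix e :: real assume "0 < e"
    then have e: "0 < e / 3" by simp
    have uc: "pointwise_uniformly_continuous T" using T by (simp add: lipschitz_functionals_def)
    obtain S d where S: "finite S" "0 < d" "\<And>f h. f \<in> lipschitz \<Longrightarrow> h \<in> lipschitz \<Longrightarrow>
        (\<And>s. s \<in> S \<Longrightarrow> \<bar>f s - h s\<bar> \<le> d) \<Longrightarrow> \<bar>T f - T h\<bar> \<le> e / 3"
      using pointwise_uniformly_continuousE[OF uc e] by blast
    define S' where "S' = {g, 0} \<union> (\<lambda>s. g + s) ` S"
    have "\<bar>shift g T f - shift g T h\<bar> \<le> e"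
      if fh: "f \<in> lipschitz" "h \<in> lipschitz" and "\<forall>s\<in>S'. \<bar>f s - h s\<bar> \<le> min d (e / 3)" for f h
    proof -
      have "\<bar>T (\<lambda>x. f (g + x)) - T (\<lambda>x. h (g + x))\<bar> \<le> e / 3"
        by (rule S(3)) (use that in \<open>auto simp: S'_def lipschitz_translate\<close>)
      moreover have "\<bar>f g - h g\<bar> \<le> e / 3" "\<bar>f 0 - h 0\<bar> \<le> e / 3"
        using that(3) by (auto simp: S'_def)
      moreover have "shift g T f - shift g T h
          = (T (\<lambda>x. f (g + x)) - T (\<lambda>x. h (g + x))) + (f g - h g) - (f 0 - h 0)"
        using fh by (simp add: shift_def)
      ultimately show ?thesis unfolding abs_le_iff by linarith
    qed
    then show "\<exists>S d. finite S \<and> 0 < d \<and> (\<forall>f\<in>lipschitz. \<forall>h\<in>lipschitz.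
        (\<forall>s\<in>S. \<bar>f s - h s\<bar> \<le> d) \<longrightarrow> \<bar>shift g T f - shift g T h\<bar> \<le> e)"
      using S(1,2) e by (intro exI[of _ S'] exI[of _ "min d (e / 3)"]) (auto simp: S'_def)
  qed
  ultimately show ?thesis
    using T by (simp add: lipschitz_functionals_def) (simp add: shift_def)
qed

lemma shift_zero: "T \<in> lipschitz_functionals \<Longrightarrow> shift 0 T = T"
  by (auto simp: shift_def lipschitz_functionals_def fun_eq_iff)

lemma shift_add: "shift (g + h) T = shift g (shift h T)"
  using lipschitz_translate[of _ g] by (auto simp: shift_def fun_eq_iff add.assoc)

lemma shift_affine:
  "shift g (\<lambda>f. (1 - t) * T f + t * T' f) = (\<lambda>f. (1 - t) * shift g T f + t * shift g T' f)"
  by (auto simp: shift_def fun_eq_iff algebra_simps)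

text \<open>
  Translating \<open>f\<close> by \<open>g\<close> changes its value at \<open>s\<close> by at most the length of the conjugate
  \<open>- s - g + s\<close>, whatever the Lipschitz function \<open>f\<close> is. This length is small for finitely many
  \<open>s\<close> at once when \<open>g\<close> is close to the identity, and \<open>T\<close> sees little more than finitely many values.
\<close>

lemma shift_close:
  assumes T: "T \<in> lipschitz_functionals" and "0 < e"
  shows "eventually (\<lambda>g. \<forall>f. \<bar>shift g T f - T f\<bar> \<le> e) (nhds 0)"
proof -
  have e: "0 < e / 2" using \<open>0 < e\<close> by simp
  have uc: "pointwise_uniformly_continuous T" using T by (simp add: lipschitz_functionals_def)
  obtain S d where S: "finite S" "0 < d" "\<And>f h. f \<in> lipschitz \<Longrightarrow> h \<in> lipschitz \<Longrightarrow>
      (\<And>s. s \<in> S \<Longrightarrow> \<bar>f s - h s\<bar> \<le> d) \<Longrightarrow> \<bar>T f - T h\<bar> \<le> e / 2"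
    using pointwise_uniformly_continuousE[OF uc e] by blast
  have "eventually (\<lambda>g. l (- (g + s) + s) < d) (nhds 0)" for s
  proof -
    have "((\<lambda>g. - (g + s) + s) \<longlongrightarrow> - (0 + s) + s) (nhds 0)"
      by (intro tendsto_intros filterlim_ident)
    then have "filterlim (\<lambda>g. - (g + s) + s) (nhds 0) (nhds 0)" by simp
    from eventually_compose_filterlim[OF length_small[OF S(2)] this] show ?thesis .
  qed
  then have "eventually (\<lambda>g. \<forall>s\<in>S. l (- (g + s) + s) < d) (nhds 0)"
    using S(1) by (simp add: eventually_ball_finite)
  then show ?thesis using length_small[OF e]
  proof eventually_elim
    case (elim g)
    have "\<bar>shift g T f - T f\<bar> \<le> e" for f
    proof (cases "f \<in> lipschitz")
      case True
      have "\<bar>T (\<lambda>x. f (g + x)) - T f\<bar> \<le> e / 2"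
      proof (rule S(3))
        show "\<bar>f (g + s) - f s\<bar> \<le> d" if "s \<in> S" for s
          using lipschitzD[OF True, of "g + s" s] elim(1) that by force
      qed (use True lipschitz_translate in auto)
      moreover have "shift g T f = T (\<lambda>x. f (g + x)) + (f g - f 0)" using True by (simp add: shift_def)
      ultimately show ?thesis using abs_increment_le[OF True, of g] elim(2) by linarith
    next
      case False
      then show ?thesis using T \<open>0 < e\<close> by (simp add: shift_def lipschitz_functionals_def)
    qed
    then show ?case by blast
  qed
qed

lemma functional_small_if_constant_on_finite:
  assumes T: "T \<in> lipschitz_functionals" and "0 < e"
  shows "\<exists>S. finite S \<and> (\<forall>f\<in>lipschitz. \<forall>c. (\<forall>s\<in>S. f s = c) \<longrightarrow> \<bar>T f\<bar> \<le> e)"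
proof -
  have uc: "pointwise_uniformly_continuous T" using T by (simp add: lipschitz_functionals_def)
  obtain S d where S: "finite S" "0 < d" "\<And>f h. f \<in> lipschitz \<Longrightarrow> h \<in> lipschitz \<Longrightarrow>
      (\<And>s. s \<in> S \<Longrightarrow> \<bar>f s - h s\<bar> \<le> d) \<Longrightarrow> \<bar>T f - T h\<bar> \<le> e"
    using pointwise_uniformly_continuousE[OF uc \<open>0 < e\<close>] by blast
  have "\<bar>T f\<bar> \<le> e" if f: "f \<in> lipschitz" "\<forall>s\<in>S. f s = c" for f c
  proof -
    have "\<bar>T (\<lambda>x. f x + - c) - T (\<lambda>_. 0)\<bar> \<le> e"
      using lipschitz_add_const[OF f(1), of "- c"] lipschitz_const[of 0] f(2) S(2)
      by (intro S(3)) auto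
    moreover have "T (\<lambda>x. f x + - c) = T f" "T (\<lambda>_. 0) = 0"
      using T f(1) unfolding lipschitz_functionals_def by blast+
    ultimately show ?thesis by simp
  qed
  then show ?thesis using S(1) by blast
qed

definition action :: "'g \<Rightarrow> 'u + (('g \<Rightarrow> real) \<Rightarrow> real) \<Rightarrow> 'u + (('g \<Rightarrow> real) \<Rightarrow> real)" where
  "action g X = Inr (shift g (projr X))"

end

theorem functional_action_continuous_affine_isometric:
  fixes l :: "'g::{topological_group_add, t2_space} \<Rightarrow> real"
  assumes "group_length l"
  shows "continuous_affine_isometric_action
     (sup_module (group_length.lipschitz_functionals l) :: (real, ('g, 'u) points) module)
     sup_norm (group_length.action l)"
proof -
  interpret group_length l by fact
  interpret uniformly_closed_subspace lipschitz_functionals by (rule lipschitz_functionals_closed_subspace)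
  let ?E = "sup_module lipschitz_functionals :: (real, ('g, 'u) points) module"
  interpret real_banach_space ?E sup_norm by (rule real_banach_space_sup_module)
  have carrier: "carrier ?E = Inr ` lipschitz_functionals" by (simp add: sup_module_def)
  show ?thesis
  proof (rule continuous_affine_isometric_actionI)
    fix g h :: 'g and X assume "X \<in> carrier ?E"
    then obtain T where T: "X = Inr T" "T \<in> lipschitz_functionals" by (auto simp: carrier)
    show "action g X \<in> carrier ?E" using T by (simp add: carrier action_def shift_in_functionals)
    show "action 0 X = X" using T by (simp add: action_def shift_zero)
    show "action (g + h) X = action g (action h X)" by (simp add: action_def shift_add)
  next
    fix X and e :: real assume "X \<in> carrier ?E" "0 < e"
    then obtain T where T: "X = Inr T" "T \<in> lipschitz_functionals" by (auto simp: carrier)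
    have "0 < e / 2" using \<open>0 < e\<close> by simp
    from shift_close[OF T(2) this] show "eventually (\<lambda>g. ndist (action g X) X < e) (nhds 0)"
    proof eventually_elim
      case (elim g)
      have "ndist (Inr (shift g T)) (Inr T) \<le> e / 2"
        unfolding ndist_le_iff[OF shift_in_functionals[OF T(2)] T(2)] by (rule elim)
      then show ?case using \<open>0 < e\<close> by (simp add: T action_def)
    qed
  next
    fix g :: 'g and X Y assume "X \<in> carrier ?E" "Y \<in> carrier ?E"
    then obtain T T' where T: "X = Inr T" "T \<in> lipschitz_functionals" "Y = Inr T'" "T' \<in> lipschitz_functionals"
      by (auto simp: carrier)
    have "ndist (Inr T) (Inr T') \<le> ndist X Y" by (simp add: T)
    then have "\<bar>T f - T' f\<bar> \<le> ndist X Y" for f unfolding ndist_le_iff[OF T(2,4)] by blast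
    then have "\<bar>shift g T f - shift g T' f\<bar> \<le> ndist X Y" for f
      using metric.nonneg[of X Y] by (simp add: shift_def)
    then have "ndist (Inr (shift g T)) (Inr (shift g T')) \<le> ndist X Y"
      unfolding ndist_le_iff[OF shift_in_functionals[OF T(2)] shift_in_functionals[OF T(4)]] by blast
    then show "ndist (action g X) (action g Y) \<le> ndist X Y" by (simp add: T action_def)
    show "action g (((1 - t) \<odot>\<^bsub>?E\<^esub> X) \<oplus>\<^bsub>?E\<^esub> (t \<odot>\<^bsub>?E\<^esub> Y))
        = ((1 - t) \<odot>\<^bsub>?E\<^esub> action g X) \<oplus>\<^bsub>?E\<^esub> (t \<odot>\<^bsub>?E\<^esub> action g Y)" for t
      by (simp add: T sup_module_def action_def shift_affine)
  qed
qed

text \<open>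
  The test function is the distance to a finite set \<open>R\<close> on which all the given functionals depend
  up to small errors, cut off at \<open>1/2\<close>. It is constant on \<open>R\<close> and on \<open>g + R\<close>, so the functionals and their translates
  contribute at most \<open>1/8\<close> each, against \<open>1/2\<close> from the cocycle; this leaves the constant \<open>1/4\<close>.
\<close>

theorem functional_action_strongly_moving:
  fixes l :: "'g::{topological_group_add, t2_space} \<Rightarrow> real"
  assumes "group_length l"
    and moves: "\<And>S. finite S \<Longrightarrow> \<exists>g. \<forall>s\<in>S. \<forall>t\<in>S. 1/2 \<le> l (- s + g + t)"
  shows "strongly_moving (carrier (sup_module (group_length.lipschitz_functionals l) :: (real, ('g, 'u) points) module))
     (real_normed_space.ndist (sup_module (group_length.lipschitz_functionals l)) sup_norm) (group_length.action l)"
proof -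
  interpret group_length l by fact
  interpret uniformly_closed_subspace lipschitz_functionals by (rule lipschitz_functionals_closed_subspace)
  let ?E = "sup_module lipschitz_functionals :: (real, ('g, 'u) points) module"
  interpret real_banach_space ?E sup_norm by (rule real_banach_space_sup_module)
  have "\<exists>g. ereal (1/4) \<le> set_distance ndist F (action g ` F)"
    if F: "finite F" "F \<subseteq> carrier ?E" for F
  proof -
    have mem: "X \<in> Inr ` lipschitz_functionals" if "X \<in> F" for X
      using F(2) that by (auto simp: sup_module_def)
    then have "\<forall>X\<in>F. \<exists>S. finite S \<and> (\<forall>f\<in>lipschitz. \<forall>c. (\<forall>s\<in>S. f s = c) \<longrightarrow> \<bar>projr X f\<bar> \<le> 1/8)"
      using functional_small_if_constant_on_finite[of _ "1/8"] by fastforce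
    then obtain S where S: "\<And>X. X \<in> F \<Longrightarrow> finite (S X)"
      "\<And>X f c. X \<in> F \<Longrightarrow> f \<in> lipschitz \<Longrightarrow> (\<forall>s\<in>S X. f s = c) \<Longrightarrow> \<bar>projr X f\<bar> \<le> 1/8"
      by metis
    (* The identity belongs to R so that the cocycle f g - f 0 equals 1/2. *)
    define R where "R = insert 0 (\<Union>X\<in>F. S X)"
    have "finite R" using F(1) S(1) by (simp add: R_def)
    from moves[OF this] obtain g where "\<forall>s\<in>R. \<forall>t\<in>R. 1/2 \<le> l (- s + g + t)" ..
    then have g: "1/2 \<le> l (- s + g + t)" if "s \<in> R" "t \<in> R" for s t using that by simp
    define f where "f = (\<lambda>x. Min (insert (1/2) ((\<lambda>s. l (- s + x)) ` R)))"
    have f: "f \<in> lipschitz" unfolding f_def by (rule lipschitz_truncated_distance) fact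
    have f_zero: "f s = 0" if "s \<in> R" for s
      unfolding f_def
    proof (rule Min_eqI)
      show "0 \<in> insert (1/2) ((\<lambda>r. l (- r + s)) ` R)"
        using that length_zero by (auto intro!: image_eqI[of _ _ s])
    qed (use \<open>finite R\<close> length_nonneg in auto)
    have f_half: "f (g + t) = 1/2" if "t \<in> R" for t
      unfolding f_def
    proof (rule Min_eqI)
      show "1/2 \<le> r" if "r \<in> insert (1/2) ((\<lambda>s. l (- s + (g + t))) ` R)" for r
        using that g[OF _ \<open>t \<in> R\<close>] by (auto simp: add.assoc)
    qed (use \<open>finite R\<close> in auto)
    have "1/4 \<le> ndist X (action g Y)" if XY: "X \<in> F" "Y \<in> F" for X Y
    proof -
      obtain T T' where T: "X = Inr T" "T \<in> lipschitz_functionals" "Y = Inr T'" "T' \<in> lipschitz_functionals"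
        using mem[OF XY(1)] mem[OF XY(2)] by blast
      have "\<bar>T f\<bar> \<le> 1/8" using S(2)[OF XY(1) f, of 0] f_zero XY(1) by (auto simp: R_def T)
      moreover have "\<bar>T' (\<lambda>x. f (g + x))\<bar> \<le> 1/8"
        using S(2)[OF XY(2) lipschitz_translate[OF f, of g], of "1/2"] f_half XY(2)
        by (auto simp: R_def T)
      moreover have "shift g T' f = T' (\<lambda>x. f (g + x)) + 1/2"
        using f f_half[of 0] f_zero[of 0] by (simp add: shift_def R_def)
      moreover have "ndist (Inr T) (Inr (shift g T')) \<le> ndist X (action g Y)"
        by (simp add: T action_def)
      then have "\<bar>T f - shift g T' f\<bar> \<le> ndist X (action g Y)"
        unfolding ndist_le_iff[OF T(2) shift_in_functionals[OF T(4)]] by blast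
      ultimately show ?thesis by linarith
    qed
    then show ?thesis
      unfolding set_distance_def by (intro exI[of _ g] INF_greatest) auto
  qed
  then show ?thesis
    unfolding strongly_moving_def strongly_moving_with_def by (intro exI[of _ "1/4"]) auto
qed

section \<open>The equivalence\<close>

lemma non_precompact_imp_moving_length:
  assumes "\<not> precompact_group TYPE('g::{topological_group_add, t2_space})"
  shows "\<exists>l::'g \<Rightarrow> real. group_length l \<and>
    (\<forall>S. finite S \<longrightarrow> (\<exists>g. \<forall>s\<in>S. \<forall>t\<in>S. 1/2 \<le> l (- s + g + t)))"
proof -
  obtain V :: "'g set" where V: "0 \<in> interior V" "\<And>F. finite F \<Longrightarrow> F + V \<noteq> UNIV"
    using assms unfolding precompact_group_def by blast
  obtain U where U: "open U" "0 \<in> U" "\<forall>w\<in>U. - w \<in> U"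
    "\<forall>a\<in>U. \<forall>b\<in>U. \<forall>c\<in>U. a + b + c \<in> interior V"
    using symmetric_cube_root[OF open_interior V(1)] by metis
  have diff: "u - v \<in> V" if "u \<in> U" "v \<in> U" for u v
  proof -
    have "u + - v + 0 \<in> interior V" using U(2-4) that by blast
    then show ?thesis using interior_subset by auto
  qed
  have no_cover: "\<exists>g. \<forall>s\<in>S. \<forall>t\<in>S. - s + g + t \<notin> U" if "finite S" for S
  proof (rule ccontr)
    assume "\<not> ?thesis"
    then obtain K where "finite K" "K + {u - v |u v. u \<in> U \<and> v \<in> U} = UNIV"
      using two_sided_syndetic_imp_syndetic_differences[OF \<open>finite S\<close>, of U] by blast
    moreover have "{u - v |u v. u \<in> U \<and> v \<in> U} \<subseteq> V" using diff by blast
    ultimately have "K + V = UNIV" using set_plus_mono2[of K K _ V] by blast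
    then show False using V(2) \<open>finite K\<close> by blast
  qed
  obtain l :: "'g \<Rightarrow> real" where l: "group_length l" "\<And>g. l g < 1/2 \<Longrightarrow> g \<in> U"
    using exists_group_length[OF U(1,2)] by blast
  have "\<exists>g. \<forall>s\<in>S. \<forall>t\<in>S. 1/2 \<le> l (- s + g + t)" if "finite S" for S
    using no_cover[OF that] l(2) by (meson not_le)
  then show ?thesis using l(1) by blast
qed

lemma (in Metric_space) strongly_moving_imp_fixed_point_free:
  assumes "strongly_moving M d \<phi>"
  shows "fixed_point_free M \<phi>"
  unfolding fixed_point_free_def
proof
  assume "\<exists>\<xi>\<in>M. \<forall>g. \<phi> g \<xi> = \<xi>"
  then obtain \<xi> where \<xi>: "\<xi> \<in> M" "\<And>g. \<phi> g \<xi> = \<xi>" by blast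
  obtain e where "0 < e" "strongly_moving_with e M d \<phi>"
    using assms unfolding strongly_moving_def by blast
  then obtain g where "ereal e \<le> set_distance d {\<xi>} (\<phi> g ` {\<xi>})"
    using \<xi>(1) unfolding strongly_moving_with_def by blast
  then show False using \<xi> \<open>0 < e\<close> by (simp add: set_distance_def)
qed

theorem theorem5p8:
  fixes G :: "'g::{topological_group_add, t2_space} itself"
  shows
    "(\<not> precompact_group G \<longleftrightarrow>
       (\<exists>(E :: (real, ('g, 'u) points) module) N (\<phi> :: 'g \<Rightarrow> ('g, 'u) points \<Rightarrow> ('g, 'u) points).
          continuous_affine_isometric_action E N \<phi> \<and> fixed_point_free (carrier E) \<phi>)) \<and>
     (\<not> precompact_group G \<longleftrightarrow>
       (\<exists>(E :: (real, ('g, 'u) points) module) N (\<phi> :: 'g \<Rightarrow> ('g, 'u) points \<Rightarrow> ('g, 'u) points).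
          continuous_affine_isometric_action E N \<phi> \<and>
          strongly_moving (carrier E) (real_normed_space.ndist E N) \<phi>))"
proof -
  have G: "precompact_group G \<longleftrightarrow> precompact_group TYPE('g)" by (simp add: precompact_group_def)
  have moving_free: "fixed_point_free (carrier E) \<phi>"
    if "continuous_affine_isometric_action E N \<phi>"
      "strongly_moving (carrier E) (real_normed_space.ndist E N) \<phi>"
    for E :: "(real, ('g, 'u) points) module" and N and \<phi> :: "'g \<Rightarrow> ('g, 'u) points \<Rightarrow> ('g, 'u) points"
  proof -
    interpret continuous_affine_isometric_action E N \<phi> by fact
    show ?thesis using that(2) by (rule metric.strongly_moving_imp_fixed_point_free)
  qed
  have free_not_precompact: "\<not> precompact_group TYPE('g)"
    if "continuous_affine_isometric_action E N \<phi>" "fixed_point_free (carrier E) \<phi>"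
    for E :: "(real, ('g, 'u) points) module" and N and \<phi> :: "'g \<Rightarrow> ('g, 'u) points \<Rightarrow> ('g, 'u) points"
    using continuous_affine_isometric_action.precompact_imp_fixed_point[OF that(1)] that(2)
    unfolding fixed_point_free_def by blast
  have moving: "\<exists>(E :: (real, ('g, 'u) points) module) N (\<phi> :: 'g \<Rightarrow> ('g, 'u) points \<Rightarrow> ('g, 'u) points).
      continuous_affine_isometric_action E N \<phi> \<and>
      strongly_moving (carrier E) (real_normed_space.ndist E N) \<phi>"
    if "\<not> precompact_group TYPE('g)"
  proof -
    obtain l :: "'g \<Rightarrow> real" where l: "group_length l"
      "\<And>S. finite S \<Longrightarrow> \<exists>g. \<forall>s\<in>S. \<forall>t\<in>S. 1/2 \<le> l (- s + g + t)"
      using non_precompact_imp_moving_length[OF \<open>\<not> precompact_group TYPE('g)\<close>] by blast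
    show ?thesis
      by (intro exI conjI) (rule functional_action_continuous_affine_isometric[OF l(1)],
        rule functional_action_strongly_moving[OF l])
  qed
  show ?thesis
    unfolding G using moving moving_free free_not_precompact by blast
qed

end
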